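(* Let $m\ge2$, $r\ge1$, $(X,T)=(\Sigma_m,\sigma)$ the full shift, $\mathbb{B}$ a real Banach space, $W\subset\mathbb{B}$, and $\Phi:\Sigma_m^r\to\mathbb{B}^*$ continuous. Let $$L_{(\Phi,W)}=\{\alpha\in\mathbb{B}^*:\ E_\Phi(\alpha,W)\neq\emptyset\},\qquad f_{(\Phi,W)}(\alpha)=h_{\rm top}(E_\Phi(\alpha,W))\ \ (\alpha\in L_{(\Phi,W)}).$$ Then $f_{(\Phi,W)}:L_{(\Phi,W)}\to\mathbb{R}$ is upper semi-continuous.
   Context: $\Sigma_m=\{0,1,\dots,m-1\}^{\mathbb{N}}$ with the product topology (compact metric) and $\sigma$ the left shift. $\mathbb{B}^*$ carries the weak-star topology $\sigma(\mathbb{B}^*,\mathbb{B})$ and $\langle\cdot,\cdot\rangle$ is the duality pairing. For $\alpha\in\mathbb{B}^*$, $E_\Phi(\alpha,W)=\{x\in\Sigma_m:\limsup_{n\to\infty}\langle V_\Phi(n,x),w\rangle\le\langle\alpha,w\rangle$ for all $w\in W\}$, where $V_\Phi(n,x)=n^{-r}\sum_{1\le i_1,\dots,i_r\le n}\Phi(\sigma^{i_1}x,\dots,\sigma^{i_r}x)$. $h_{\rm top}(Z)$ is Bowen's topological entropy of a set $Z$: with $d_n(x,y)=\max_{0\le j<n}d(\sigma^jx,\sigma^jy)$, $B_n(x,\epsilon)$ the $d_n$-balls, $H^s_n(Z,\epsilon)=\inf\sum_ie^{-sn_i}$ over countable covers of $Z$ by balls $B_{n_i}(x_i,\epsilon)$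 with $n_i\ge n$, $H^s(Z,\epsilon)=\lim_nH^s_n(Z,\epsilon)$, $h_{\rm top}(Z,\epsilon)$ the critical value of $s$, and $h_{\rm top}(Z)=\lim_{\epsilon\to0}h_{\rm top}(Z,\epsilon)$. *)

theory Defs
  imports "HOL-Analysis.Analysis" "HOL-Library.Extended_Real" "HOL-Library.Extended_Nonnegative_Real"
begin

definition shift_space :: "nat \<Rightarrow> (nat \<Rightarrow> nat) topology" where
  "shift_space m = product_topology (\<lambda>_. discrete_topology {..<m}) UNIV"

definition Sigma_m :: "nat \<Rightarrow> (nat \<Rightarrow> nat) set" where
  "Sigma_m m = {x. \<forall>n. x n < m}"

definition shift :: "(nat \<Rightarrow> nat) \<Rightarrow> (nat \<Rightarrow> nat)" where
  "shift x = (\<lambda>n. x (Suc n))"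

text \<open>Sigma_m^r: r-tuples of points, represented as functions on {..<r} (extensional).\<close>
definition shift_power_space :: "nat \<Rightarrow> nat \<Rightarrow> (nat \<Rightarrow> (nat \<Rightarrow> nat)) topology" where
  "shift_power_space m r = product_topology (\<lambda>_. shift_space m) {..<r}"

definition sdist :: "(nat \<Rightarrow> nat) \<Rightarrow> (nat \<Rightarrow> nat) \<Rightarrow> real" where
  "sdist x y = (if x = y then 0 else (1/2) ^ (LEAST n. x n \<noteq> y n))"

definition weak_star :: "('b::real_normed_vector \<Rightarrow>\<^sub>L real) topology" where
  "weak_star = topology_generated_by
     {{\<alpha>. blinfun_apply \<alpha> w \<in> U} | w U. open (U::real set)}"

definition V_Phi ::
  "nat \<Rightarrow> ((nat \<Rightarrow> (nat \<Rightarrow> nat)) \<Rightarrow> ('b::real_normed_vector \<Rightarrow>\<^sub>L real))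
     \<Rightarrow> nat \<Rightarrow> (nat \<Rightarrow> nat) \<Rightarrow> ('b \<Rightarrow>\<^sub>L real)" where
  "V_Phi r \<Phi> n x = (1 / real n ^ r) *\<^sub>R
     (\<Sum>i\<in>PiE {..<r} (\<lambda>_. {1..n}). \<Phi> (\<lambda>j\<in>{..<r}. (shift ^^ i j) x))"

definition E_Phi ::
  "nat \<Rightarrow> nat \<Rightarrow> ((nat \<Rightarrow> (nat \<Rightarrow> nat)) \<Rightarrow> ('b::real_normed_vector \<Rightarrow>\<^sub>L real))
     \<Rightarrow> ('b \<Rightarrow>\<^sub>L real) \<Rightarrow> 'b set \<Rightarrow> (nat \<Rightarrow> nat) set" where
  "E_Phi m r \<Phi> \<alpha> W = {x \<in> Sigma_m m. \<forall>w\<in>W.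
      limsup (\<lambda>n. ereal (blinfun_apply (V_Phi r \<Phi> n x) w)) \<le> ereal (blinfun_apply \<alpha> w)}"

definition bowen_dist :: "nat \<Rightarrow> (nat \<Rightarrow> nat) \<Rightarrow> (nat \<Rightarrow> nat) \<Rightarrow> real" where
  "bowen_dist n x y = Max (insert 0 ((\<lambda>j. sdist ((shift ^^ j) x) ((shift ^^ j) y)) ` {..<n}))"

definition bowen_ball :: "nat \<Rightarrow> nat \<Rightarrow> (nat \<Rightarrow> nat) \<Rightarrow> real \<Rightarrow> (nat \<Rightarrow> nat) set" where
  "bowen_ball m n x \<epsilon> = {y \<in> Sigma_m m. bowen_dist n x y < \<epsilon>}"

definition H_n :: "nat \<Rightarrow> real \<Rightarrow> (nat \<Rightarrow> nat) set \<Rightarrow> real \<Rightarrow> nat \<Rightarrow> ennreal" where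
  "H_n m s Z \<epsilon> n = (INF C \<in> {C. countable C \<and> (\<forall>(k, x)\<in>C. n \<le> k \<and> x \<in> Sigma_m m) \<and>
                          Z \<subseteq> (\<Union>(k, x)\<in>C. bowen_ball m k x \<epsilon>)}.
                    (\<Sum>\<^sub>\<infinity>(k, x)\<in>C. ennreal (exp (- s * real k))))"

text \<open>H^s(Z,eps) = lim_n H^s_n(Z,eps); the sequence is nondecreasing in n, so this is a sup.\<close>
definition H_s :: "nat \<Rightarrow> real \<Rightarrow> (nat \<Rightarrow> nat) set \<Rightarrow> real \<Rightarrow> ennreal" where
  "H_s m s Z \<epsilon> = (SUP n. H_n m s Z \<epsilon> n)"

definition htop_eps :: "nat \<Rightarrow> (nat \<Rightarrow> nat) set \<Rightarrow> real \<Rightarrow> ereal" where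
  "htop_eps m Z \<epsilon> = Inf {ereal s | s. H_s m s Z \<epsilon> = 0}"

text \<open>h_top(Z) = lim_{eps -> 0} h_top(Z, eps); nondecreasing as eps decreases, so a sup.\<close>
definition htop :: "nat \<Rightarrow> (nat \<Rightarrow> nat) set \<Rightarrow> ereal" where
  "htop m Z = (SUP \<epsilon> \<in> {0<..}. htop_eps m Z \<epsilon>)"

end

theory Submission
  imports Defs "HOL-Probability.Infinite_Product_Measure"
begin

text \<open>
  The empirical word frequencies of an orbit determine \<open>V\<^sub>\<Phi>\<close> up to uniformly small errors, since
  each scalar kernel \<open>\<langle>\<Phi>, w\<rangle>\<close> is uniformly close to a locally constant one, whose average is a
  polynomial in the frequencies. Fix \<open>\<alpha>\<^sub>0\<close> and, for finite \<open>F \<subseteq> W\<close> and \<open>d > 0\<close>, count the \<open>n\<close>-words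
  having an extension \<open>x\<close> with \<open>\<langle>V\<^sub>\<Phi>(n, x), w\<rangle> \<le> \<langle>\<alpha>\<^sub>0, w\<rangle> + d\<close> on \<open>F\<close>. If for some \<open>(F, d)\<close> there are
  eventually fewer than \<open>exp (c n)\<close> of them, then they cover \<open>E\<^sub>\<Phi>(\<alpha>, W)\<close> for every \<open>\<alpha>\<close> in the weak-star
  neighbourhood \<open>{\<alpha>. \<forall>w\<in>F. \<langle>\<alpha>, w\<rangle> < \<langle>\<alpha>\<^sub>0, w\<rangle> + d}\<close> economically, so the entropy is at most \<open>c\<close> there.
  Otherwise compactness yields a frequency vector \<open>\<nu>\<close> every neighbourhood of which contains, for every
  \<open>(F, d)\<close>, exponentially many of these words. Concatenating blocks with frequencies approaching \<open>\<nu>\<close>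
  gives points of \<open>E\<^sub>\<Phi>(\<alpha>\<^sub>0, W)\<close>; it is because \<open>V\<^sub>\<Phi>\<close> is not affine in the empirical measure that
  all blocks must share one limit frequency. The mass distribution principle then shows that
  \<open>E\<^sub>\<Phi>(\<alpha>\<^sub>0, W)\<close> has entropy close to \<open>c\<close>.
\<close>

section \<open>Words, covers and upper bounds for the entropy\<close>

definition word_prefix :: "nat \<Rightarrow> (nat \<Rightarrow> nat) \<Rightarrow> nat list" where
  "word_prefix n x = map x [0..<n]"

lemma word_prefix_eq_iff: "word_prefix n x = word_prefix n y \<longleftrightarrow> (\<forall>t<n. x t = y t)"
  by (auto simp: word_prefix_def)

lemma funpow_shift: "(shift ^^ i) x = (\<lambda>t. x (i + t))"
  by (induction i arbitrary: x) (auto simp: shift_def)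

lemma funpow_shift_in_Sigma_m: "x \<in> Sigma_m m \<Longrightarrow> (shift ^^ i) x \<in> Sigma_m m"
  by (auto simp: funpow_shift Sigma_m_def)

lemma finite_word_prefix_image:
  assumes "S \<subseteq> Sigma_m m"
  shows "finite (word_prefix n ` S)"
proof (rule finite_subset)
  show "word_prefix n ` S \<subseteq> {xs. set xs \<subseteq> {..<m} \<and> length xs = n}"
    using assms by (auto simp: word_prefix_def Sigma_m_def subset_iff)
qed (simp add: finite_lists_length_eq)

text \<open>One point per prefix turns a count of words into a finite set of points of the same
  size. Such sets serve both as centres of Bowen balls and as alphabets of blocks.\<close>

lemma obtain_prefix_representatives:
  assumes "S \<subseteq> Sigma_m m"
  obtains D where "D \<subseteq> S" "finite D" "inj_on (word_prefix n) D"
    "word_prefix n ` D = word_prefix n ` S"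
proof -
  obtain D where D: "D \<subseteq> S" "inj_on (word_prefix n) D" "word_prefix n ` S = word_prefix n ` D"
    using subset_image_inj[of "word_prefix n ` S" "word_prefix n" S] by auto
  have "finite D"
    using finite_word_prefix_image[OF assms, of n] D by (metis finite_image_iff)
  then show ?thesis using D that by metis
qed

lemma sdist_le:
  assumes "\<And>t. t < p \<Longrightarrow> x t = y t"
  shows "sdist x y \<le> (1/2) ^ p"
proof (cases "x = y")
  case False
  then obtain t where "x t \<noteq> y t" by auto
  then have "x (LEAST t. x t \<noteq> y t) \<noteq> y (LEAST t. x t \<noteq> y t)" by (rule LeastI)
  then have "p \<le> (LEAST t. x t \<noteq> y t)" using assms by (meson not_less)
  then show ?thesis using False by (simp add: sdist_def power_decreasing)
qed (simp add: sdist_def)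

lemma sdist_less_1D:
  assumes "sdist x y < 1"
  shows "x 0 = y 0"
proof (rule ccontr)
  assume "x 0 \<noteq> y 0"
  then have "(LEAST t. x t \<noteq> y t) = 0" "x \<noteq> y" by auto
  with assms show False by (simp add: sdist_def)
qed

text \<open>For \<open>j < n\<close> the first \<open>p\<close> symbols of the \<open>j\<close>-th
  iterate lie among the first \<open>n + p\<close> symbols of the point. These \<open>p\<close>
  extra symbols are the price for passing from words to balls of radius
  \<open>\<epsilon>\<close>.\<close>

lemma bowen_dist_lessI:
  assumes "\<And>t. t < n + p \<Longrightarrow> x t = y t" "(1/2) ^ p < \<epsilon>"
  shows "bowen_dist n x y < \<epsilon>"
proof -
  have "sdist ((shift ^^ j) x) ((shift ^^ j) y) < \<epsilon>" if "j < n" for j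
    using sdist_le[of p "(shift ^^ j) x" "(shift ^^ j) y"] assms that
    by (force simp: funpow_shift)
  \<comment> \<open>The default value 0 in the maximum must also lie below
    \<open>\<epsilon>\<close>; it is the only element when \<open>n = 0\<close>.\<close>
  moreover have "0 < \<epsilon>" using assms(2) by (meson le_less_trans zero_le_divide_1_iff zero_le_numeral zero_le_power)
  ultimately show ?thesis by (auto simp: bowen_dist_def)
qed

text \<open>Points that differ in their first symbol are at distance exactly 1, so at radius 1 a
  Bowen ball of order \<open>n\<close> fixes \<open>n\<close> symbols. Lower bounds therefore work
  at this radius.\<close>

lemma bowen_dist_less_1D:
  assumes "bowen_dist n x y < 1" "t < n"
  shows "x t = y t"
  using assms sdist_less_1D[of "(shift ^^ t) x" "(shift ^^ t) y"]
  by (auto simp: bowen_dist_def funpow_shift)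

section \<open>Entropy bounds from weights of covers\<close>

lemma infsum_ennreal_leI:
  fixes f :: "'a \<Rightarrow> ennreal"
  assumes "\<And>F. finite F \<Longrightarrow> F \<subseteq> A \<Longrightarrow> sum f F \<le> b"
  shows "infsum f A \<le> b"
  by (subst nonneg_infsum_complete) (auto intro!: SUP_least assms)

text \<open>Lowering the exponent only increases the weight of a cover, so no exponent below
  \<open>s\<close> has vanishing \<open>H_s\<close> at radius 1; and \<open>htop\<close> is a
  supremum over radii.\<close>

lemma htop_eps_1_geI:
  assumes "\<And>C. countable C \<Longrightarrow> (\<And>k x. (k, x) \<in> C \<Longrightarrow> n \<le> k \<and> x \<in> Sigma_m m) \<Longrightarrow>
      Z \<subseteq> (\<Union>(k, x)\<in>C. bowen_ball m k x 1) \<Longrightarrow>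
      1 \<le> (\<Sum>\<^sub>\<infinity>(k, x)\<in>C. ennreal (exp (- s * real k)))"
  shows "ereal s \<le> htop m Z"
proof -
  have "ereal s \<le> htop_eps m Z 1"
    unfolding htop_eps_def
  proof (rule Inf_greatest, clarsimp)
    fix s' :: real assume s': "H_s m s' Z 1 = 0"
    show "s \<le> s'"
    proof (rule ccontr)
      assume "\<not> s \<le> s'"
      have "1 \<le> H_n m s' Z 1 n"
        unfolding H_n_def
      proof (rule INF_greatest, clarsimp)
        fix C assume C: "countable C" "\<forall>x\<in>C. case x of (k, x) \<Rightarrow> n \<le> k \<and> x \<in> Sigma_m m"
          "Z \<subseteq> (\<Union>x\<in>C. case x of (k, x) \<Rightarrow> bowen_ball m k x 1)"
        have "1 \<le> (\<Sum>\<^sub>\<infinity>(k, x)\<in>C. ennreal (exp (- s * real k)))"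
          using C by (intro assms) auto
        also have "\<dots> \<le> (\<Sum>\<^sub>\<infinity>(k, x)\<in>C. ennreal (exp (- s' * real k)))"
          using \<open>\<not> s \<le> s'\<close>
          by (intro infsum_mono nonneg_summable_on_complete)
            (auto intro!: ennreal_leI mult_right_mono)
        finally show "1 \<le> (\<Sum>\<^sub>\<infinity>(k, x)\<in>C. ennreal (exp (- (s' * real k))))" by simp
      qed
      also have "\<dots> \<le> H_s m s' Z 1" unfolding H_s_def by (rule SUP_upper) simp
      finally show False using s' by simp
    qed
  qed
  also have "\<dots> \<le> htop m Z" unfolding htop_def by (rule SUP_upper) simp
  finally show ?thesis .
qed

text \<open>The infimum in \<open>htop_eps\<close> runs over all reals, negative ones included. At
  exponent 0 every ball weighs 1, and a cover of a nonempty set contains at least one ball.\<close>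

lemma htop_nonneg:
  assumes "Z \<noteq> {}"
  shows "0 \<le> htop m Z"
proof -
  have "ereal 0 \<le> htop m Z"
  proof (rule htop_eps_1_geI[where n = 0])
    fix C :: "(nat \<times> (nat \<Rightarrow> nat)) set"
    assume "Z \<subseteq> (\<Union>(k, x)\<in>C. bowen_ball m k x 1)"
    moreover obtain z where "z \<in> Z" using assms by blast
    ultimately obtain c where "c \<in> C" by blast
    then have "infsum (\<lambda>_. 1 :: ennreal) {c} \<le> infsum (\<lambda>_. 1) C"
      by (intro infsum_mono_neutral nonneg_summable_on_complete) auto
    then show "1 \<le> (\<Sum>\<^sub>\<infinity>(k, x)\<in>C. ennreal (exp (- 0 * real k)))" by (simp add: case_prod_unfold)
  qed
  then show ?thesis by (simp add: zero_ereal_def)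
qed

text \<open>The cover takes, for every order \<open>n \<ge> N\<close>, one ball per prefix of length
  \<open>n + p\<close> occurring in \<open>S (n + p)\<close>. Its weight is at most a geometric
  series of ratio \<open>exp (t - s)\<close>, and the factor \<open>exp (t * p)\<close> pays for the
  \<open>p\<close> extra symbols.\<close>

lemma H_n_geometric_le:
  assumes cover: "\<And>x. x \<in> Z \<Longrightarrow> \<exists>n\<ge>N. x \<in> S (n + p)"
    and S: "\<And>n. S n \<subseteq> Sigma_m m" and Z: "Z \<subseteq> Sigma_m m"
    and card: "\<And>n. n \<ge> N \<Longrightarrow> card (word_prefix n ` S n) \<le> exp (t * real n)"
    and st: "t < s" and p: "(1/2) ^ p < \<epsilon>"
  shows "H_n m s Z \<epsilon> N \<le> ennreal (exp (t * p) * (exp (t - s) ^ N / (1 - exp (t - s))))"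
proof -
  define q where "q = exp (t - s)"
  have q: "0 < q" "q < 1" using st by (auto simp: q_def)
  have "\<exists>D. D \<subseteq> S (n + p) \<and> finite D \<and> inj_on (word_prefix (n + p)) D \<and>
      word_prefix (n + p) ` D = word_prefix (n + p) ` S (n + p)" for n
    using obtain_prefix_representatives[OF S, of "n + p" "n + p"] by metis
  then obtain D where D: "\<And>n. D n \<subseteq> S (n + p)" "\<And>n. finite (D n)"
    "\<And>n. inj_on (word_prefix (n + p)) (D n)"
    "\<And>n. word_prefix (n + p) ` D n = word_prefix (n + p) ` S (n + p)"
    by metis
  have cardD: "card (D n) \<le> exp (t * real (n + p))" if "n \<ge> N" for n
    using card[of "n + p"] that card_image[OF D(3)[of n]] D(4)[of n] by simp
  define C where "C = (SIGMA n:{N..}. D n)"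
  have "countable C"
    unfolding C_def using D(2) by (intro countable_SIGMA) (auto simp: countable_finite)
  moreover have "\<forall>(k, x)\<in>C. N \<le> k \<and> x \<in> Sigma_m m"
    using D(1) S by (auto simp: C_def)
  moreover have "Z \<subseteq> (\<Union>(k, x)\<in>C. bowen_ball m k x \<epsilon>)"
  proof
    fix x assume x: "x \<in> Z"
    then obtain n where n: "n \<ge> N" "x \<in> S (n + p)" using cover by blast
    then obtain y where y: "y \<in> D n" "word_prefix (n + p) y = word_prefix (n + p) x"
      using D(4)[of n] by (metis imageE imageI)
    then have "bowen_dist n y x < \<epsilon>"
      using p by (intro bowen_dist_lessI) (auto simp: word_prefix_eq_iff)
    then show "x \<in> (\<Union>(k, x)\<in>C. bowen_ball m k x \<epsilon>)"
      using x Z n y by (auto simp: C_def bowen_ball_def)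
  qed
  ultimately have "H_n m s Z \<epsilon> N \<le> (\<Sum>\<^sub>\<infinity>(k, x)\<in>C. ennreal (exp (- s * real k)))"
    unfolding H_n_def by (intro INF_lower) auto
  also have "\<dots> \<le> ennreal (exp (t * p) * (q ^ N / (1 - q)))"
  proof (rule infsum_ennreal_leI)
    fix F assume F: "finite F" "F \<subseteq> C"
    \<comment> \<open>A finite part of the cover involves boundedly many orders, so finite sums
      suffice for the estimate.\<close>
    obtain N' where N': "fst ` F \<subseteq> {..<N'}"
      using F(1) finite_nat_iff_bounded by blast
    have "F \<subseteq> (SIGMA n:{N..<N'}. D n)" using F(2) N' by (force simp: C_def)
    then have "(\<Sum>(k, x)\<in>F. exp (- s * real k)) \<le> (\<Sum>(k, x)\<in>(SIGMA n:{N..<N'}. D n). exp (- s * real k))"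
      using D(2) by (intro sum_mono2) auto
    also have "\<dots> = (\<Sum>k\<in>{N..<N'}. card (D k) * exp (- s * real k))"
      using D(2) by (subst sum.Sigma[symmetric]) auto
    also have "\<dots> \<le> (\<Sum>k\<in>{N..<N'}. exp (t * p) * q ^ k)"
    proof (rule sum_mono)
      fix k assume "k \<in> {N..<N'}"
      then have "card (D k) * exp (- s * real k) \<le> exp (t * real (k + p)) * exp (- s * real k)"
        using cardD by (intro mult_right_mono) auto
      also have "\<dots> = exp (t * p) * q ^ k"
        by (simp add: q_def algebra_simps flip: exp_add exp_of_nat_mult)
      finally show "card (D k) * exp (- s * real k) \<le> exp (t * p) * q ^ k" .
    qed
    also have "\<dots> = exp (t * p) * (\<Sum>k\<in>{N..<N'}. q ^ k)" by (simp add: sum_distrib_left)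
    also have "\<dots> \<le> exp (t * p) * (q ^ N / (1 - q))"
    proof (rule mult_left_mono)
      have "(\<Sum>k\<in>{N..<N'}. q ^ k) \<le> (\<Sum>k. q ^ (k + N))"
      proof -
        have "(\<Sum>k\<in>{N..<N'}. q ^ k) = (\<Sum>k<N' - N. q ^ (k + N))"
          by (rule sum.reindex_bij_witness[of _ "\<lambda>k. k + N" "\<lambda>k. k - N"]) auto
        also have "\<dots> \<le> (\<Sum>k. q ^ (k + N))"
          using q by (intro sum_le_suminf) (auto simp: power_add intro!: summable_mult2 summable_geometric)
        finally show ?thesis .
      qed
      also have "\<dots> = q ^ N / (1 - q)"
        using q by (simp add: power_add suminf_mult2[symmetric] summable_geometric suminf_geometric)
      finally show "(\<Sum>k\<in>{N..<N'}. q ^ k) \<le> q ^ N / (1 - q)" .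
    qed simp
    finally show "(\<Sum>(k, x)\<in>F. ennreal (exp (- s * real k))) \<le> ennreal (exp (t * p) * (q ^ N / (1 - q)))"
      by (simp add: case_prod_unfold sum_ennreal ennreal_leI)
  qed
  finally show ?thesis by (simp add: q_def)
qed

text \<open>For every \<open>s > t\<close> the covers by balls of order at least \<open>k\<close>
  have weights bounded by the tail of a convergent geometric series, which vanishes as
  \<open>k\<close> grows.\<close>

lemma htop_le:
  assumes Z: "Z \<subseteq> Sigma_m m" and S: "\<And>n. S n \<subseteq> Sigma_m m"
    and cover: "\<And>x. x \<in> Z \<Longrightarrow> eventually (\<lambda>n. x \<in> S n) sequentially"
    and card: "eventually (\<lambda>n. card (word_prefix n ` S n) \<le> exp (t * real n)) sequentially"
  shows "htop m Z \<le> ereal t"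
  unfolding htop_def
proof (rule SUP_least)
  fix \<epsilon> :: real assume "\<epsilon> \<in> {0<..}"
  then obtain p where p: "(1/2) ^ p < \<epsilon>"
    using real_arch_pow_inv[of \<epsilon> "1/2"] by auto
  show "htop_eps m Z \<epsilon> \<le> ereal t"
  proof (rule ereal_le_epsilon2)
    fix e :: real assume "0 < e"
    define s where "s = t + e"
    define q where "q = exp (t - s)"
    have st: "t < s" using \<open>0 < e\<close> by (simp add: s_def)
    then have q: "0 < q" "q < 1" by (auto simp: q_def)
    obtain N where N: "\<And>n. n \<ge> N \<Longrightarrow> card (word_prefix n ` S n) \<le> exp (t * real n)"
      using card by (auto simp: eventually_sequentially)
    have "H_n m s Z \<epsilon> n = 0" for n
    proof -
      have le: "H_n m s Z \<epsilon> n \<le> ennreal (exp (t * p) * (q ^ k / (1 - q)))"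
        if k: "k \<ge> max n N" for k
      proof -
        \<comment> \<open>Larger minimal orders admit fewer covers, so the infimum grows with
          \<open>k\<close>, and \<open>k\<close> may be sent to infinity.\<close>
        have "H_n m s Z \<epsilon> n \<le> H_n m s Z \<epsilon> k"
          unfolding H_n_def using k by (intro INF_superset_mono) fastforce+
        also have "\<dots> \<le> ennreal (exp (t * p) * (q ^ k / (1 - q)))"
          unfolding q_def
        proof (rule H_n_geometric_le[OF _ S Z _ st p])
          fix x assume "x \<in> Z"
          then obtain n1 where "\<And>n. n \<ge> n1 \<Longrightarrow> x \<in> S n"
            using cover by (auto simp: eventually_sequentially)
          then show "\<exists>n\<ge>k. x \<in> S (n + p)" by (intro exI[of _ "max k n1"]) auto
        qed (use N k in auto)
        finally show ?thesis .
      qed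
      have "(\<lambda>k. exp (t * p) * (q ^ k / (1 - q))) \<longlonglongrightarrow> exp (t * p) * (0 / (1 - q))"
        using q by (intro tendsto_intros LIMSEQ_realpow_zero) auto
      then have "(\<lambda>k. ennreal (exp (t * p) * (q ^ k / (1 - q)))) \<longlonglongrightarrow> ennreal (exp (t * p) * (0 / (1 - q)))"
        by (rule tendsto_ennrealI)
      then have "H_n m s Z \<epsilon> n \<le> ennreal (exp (t * p) * (0 / (1 - q)))"
        by (rule LIMSEQ_le_const) (use le in blast)
      then show ?thesis by simp
    qed
    then have "H_s m s Z \<epsilon> = 0" by (simp add: H_s_def)
    then have "htop_eps m Z \<epsilon> \<le> ereal s" unfolding htop_eps_def by (intro Inf_lower) auto
    then show "htop_eps m Z \<epsilon> \<le> ereal t + ereal e" by (simp add: s_def)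
  qed
qed

section \<open>Word frequencies and V-statistics\<close>

lemma topspace_shift_space: "topspace (shift_space m) = Sigma_m m"
  by (auto simp: shift_space_def Sigma_m_def PiE_def Pi_def)

lemma topspace_shift_power_space:
  "topspace (shift_power_space m r) = PiE {..<r} (\<lambda>_. Sigma_m m)"
  by (simp add: shift_power_space_def topspace_shift_space)

lemma compact_space_shift_power_space: "compact_space (shift_power_space m r)"
  by (simp add: shift_power_space_def shift_space_def compact_space_product_topology
      compact_space_discrete_topology)

definition power_cylinder :: "nat \<Rightarrow> nat \<Rightarrow> nat \<Rightarrow> (nat \<Rightarrow> nat \<Rightarrow> nat) \<Rightarrow> (nat \<Rightarrow> nat \<Rightarrow> nat) set" where
  "power_cylinder m r p a =
     {b \<in> topspace (shift_power_space m r). \<forall>j<r. word_prefix p (b j) = word_prefix p (a j)}"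

text \<open>A cylinder is a finite intersection of preimages of single symbols under continuous maps
  into a discrete space.\<close>

lemma openin_power_cylinder:
  assumes "a \<in> topspace (shift_power_space m r)"
  shows "openin (shift_power_space m r) (power_cylinder m r p a)"
proof -
  let ?T = "shift_power_space m r"
  have "openin ?T ((\<Inter>(j, t)\<in>{..<r} \<times> {..<p}. {b \<in> topspace ?T. b j t \<in> {a j t}}) \<inter> topspace ?T)"
  proof (rule openin_INT)
    fix jt assume "jt \<in> {..<r} \<times> {..<p}"
    then obtain j t where jt: "jt = (j, t)" and "j < r" "t < p" by auto
    have "continuous_map ?T (shift_space m) (\<lambda>b. b j)"
      unfolding shift_power_space_def
      by (rule continuous_map_product_coordinates) (use \<open>j < r\<close> in simp)
    moreover have "continuous_map (shift_space m) (discrete_topology {..<m}) (\<lambda>y. y t)"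
      unfolding shift_space_def by (rule continuous_map_product_coordinates) simp
    ultimately have "continuous_map ?T (discrete_topology {..<m}) (\<lambda>b. b j t)"
      using continuous_map_compose by (force simp: o_def)
    moreover have "a j t < m"
      using assms \<open>j < r\<close> by (auto simp: topspace_shift_power_space Sigma_m_def PiE_def Pi_def)
    ultimately show "openin ?T (case jt of (j, t) \<Rightarrow> {b \<in> topspace ?T. b j t \<in> {a j t}})"
      using openin_continuous_map_preimage[of ?T _ "\<lambda>b. b j t" "{a j t}"] by (simp add: jt)
  qed simp
  also have "(\<Inter>(j, t)\<in>{..<r} \<times> {..<p}. {b \<in> topspace ?T. b j t \<in> {a j t}}) \<inter> topspace ?T
      = power_cylinder m r p a"
    by (auto simp: power_cylinder_def word_prefix_eq_iff)
  finally show ?thesis .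
qed

text \<open>A basic open set of the product topology restricts finitely many coordinates;
  \<open>p\<close> is taken beyond all of them.\<close>

lemma shift_space_nhd_contains_cylinder:
  assumes "openin (shift_space m) U" "a \<in> U"
  shows "\<exists>p. \<forall>b\<in>Sigma_m m. word_prefix p b = word_prefix p a \<longrightarrow> b \<in> U"
proof -
  obtain V where V: "finite {t. V t \<noteq> {..<m}}" "a \<in> PiE UNIV V" "PiE UNIV V \<subseteq> U"
    using assms unfolding shift_space_def openin_product_topology_alt by auto
  obtain p where p: "{t. V t \<noteq> {..<m}} \<subseteq> {..<p}"
    using V(1) finite_nat_iff_bounded by blast
  show ?thesis
  proof (intro exI ballI impI)
    fix b assume b: "b \<in> Sigma_m m" "word_prefix p b = word_prefix p a"
    have "b t \<in> V t" for t
    proof (cases "V t = {..<m}")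
      case False
      then have "t < p" using p by auto
      then show ?thesis using b V(2) by (auto simp: word_prefix_eq_iff)
    qed (use b in \<open>auto simp: Sigma_m_def\<close>)
    then show "b \<in> U" using V(3) by auto
  qed
qed

lemma power_nhd_contains_cylinder:
  assumes "openin (shift_power_space m r) U" "a \<in> U"
  shows "\<exists>p. power_cylinder m r p a \<subseteq> U"
proof -
  obtain V where V: "\<And>j. j < r \<Longrightarrow> openin (shift_space m) (V j)"
    "a \<in> PiE {..<r} V" "PiE {..<r} V \<subseteq> U"
    using assms unfolding shift_power_space_def openin_product_topology_alt
    by (metis lessThan_iff)
  have "\<exists>p. \<forall>b\<in>Sigma_m m. word_prefix p b = word_prefix p (a j) \<longrightarrow> b \<in> V j" if "j < r" for j
    using that V by (intro shift_space_nhd_contains_cylinder) auto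
  then obtain P where P: "\<And>j b. j < r \<Longrightarrow> b \<in> Sigma_m m \<Longrightarrow>
      word_prefix (P j) b = word_prefix (P j) (a j) \<Longrightarrow> b \<in> V j"
    by metis
  obtain p where p: "P ` {..<r} \<subseteq> {..<p}"
    by (metis finite_imageI finite_lessThan finite_nat_iff_bounded)
  have "power_cylinder m r p a \<subseteq> PiE {..<r} V"
  proof
    fix b assume b: "b \<in> power_cylinder m r p a"
    have "b j \<in> V j" if "j < r" for j
    proof (rule P[OF that])
      have "P j < p" using p that by auto
      then show "word_prefix (P j) (b j) = word_prefix (P j) (a j)"
        using b that by (simp add: power_cylinder_def word_prefix_eq_iff)
    qed (use b that in \<open>auto simp: power_cylinder_def topspace_shift_power_space\<close>)
    then show "b \<in> PiE {..<r} V"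
      using b by (auto simp: power_cylinder_def topspace_shift_power_space PiE_def)
  qed
  then show ?thesis using V(3) by blast
qed

text \<open>A Lebesgue number argument. Finitely many cylinders, on each of which
  \<open>\<phi>\<close> stays within \<open>e / 2\<close> of its value at the centre, cover the
  compact space. If \<open>p\<close> exceeds all their lengths, every cylinder of length
  \<open>p\<close> lies inside one of them.\<close>

lemma shift_power_uniformly_continuous:
  assumes cont: "continuous_map (shift_power_space m r) euclideanreal \<phi>" and "0 < e"
  obtains p where "\<And>a b. a \<in> topspace (shift_power_space m r) \<Longrightarrow> b \<in> power_cylinder m r p a \<Longrightarrow>
    \<bar>\<phi> a - \<phi> b\<bar> < e"
proof -
  let ?T = "shift_power_space m r"
  have "\<exists>p. \<forall>b\<in>power_cylinder m r p a. \<bar>\<phi> a - \<phi> b\<bar> < e / 2" if a: "a \<in> topspace ?T" for a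
  proof -
    have "openin ?T {b \<in> topspace ?T. \<phi> b \<in> ball (\<phi> a) (e / 2)}"
      by (rule openin_continuous_map_preimage[OF cont]) simp
    then obtain p where "power_cylinder m r p a \<subseteq> {b \<in> topspace ?T. \<phi> b \<in> ball (\<phi> a) (e / 2)}"
      using power_nhd_contains_cylinder a \<open>0 < e\<close> by (metis (no_types, lifting) centre_in_ball half_gt_zero mem_Collect_eq)
    then show ?thesis by (auto simp: dist_real_def)
  qed
  then obtain P where P: "\<And>a b. a \<in> topspace ?T \<Longrightarrow> b \<in> power_cylinder m r (P a) a \<Longrightarrow> \<bar>\<phi> a - \<phi> b\<bar> < e / 2"
    by metis
  let ?\<U> = "(\<lambda>a. power_cylinder m r (P a) a) ` topspace ?T"
  have "topspace ?T \<subseteq> \<Union>?\<U>" by (auto simp: power_cylinder_def)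
  moreover have "\<forall>U\<in>?\<U>. openin ?T U" by (auto intro: openin_power_cylinder)
  ultimately obtain \<F> where \<F>: "finite \<F>" "\<F> \<subseteq> ?\<U>" "topspace ?T \<subseteq> \<Union>\<F>"
    using compact_space_shift_power_space[of m r] unfolding compact_space_alt by meson
  obtain F where F: "finite F" "F \<subseteq> topspace ?T" "\<F> = (\<lambda>a. power_cylinder m r (P a) a) ` F"
    using finite_subset_image[OF \<F>(1,2)] by blast
  obtain p where p: "P ` F \<subseteq> {..<p}"
    using finite_imageI[OF F(1)] finite_nat_iff_bounded by blast
  show ?thesis
  proof (rule that)
    fix a b assume ab: "a \<in> topspace ?T" "b \<in> power_cylinder m r p a"
    then obtain c where c: "c \<in> F" "a \<in> power_cylinder m r (P c) c"
      using \<F>(3) F(3) by blast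
    then have "P c < p" using p by auto
    then have "b \<in> power_cylinder m r (P c) c"
      using ab c by (auto simp: power_cylinder_def word_prefix_eq_iff)
    then show "\<bar>\<phi> a - \<phi> b\<bar> < e" 
      using P[of c a] P[of c b] c F(2) unfolding abs_less_iff by (smt (verit) field_sum_of_halves subsetD)
  qed
qed

text \<open>For \<open>n > 0\<close> this is the mass that the empirical measure of the points
  \<open>(shift ^^ i) x\<close>, with \<open>i\<close> from 1 to \<open>n\<close> as in
  \<open>V_Phi\<close>, gives to the cylinder of \<open>v\<close>. Words of all lengths are recorded
  at once, so \<open>word_freq n x\<close> is a point of a countable product of intervals.\<close>

definition word_freq :: "nat \<Rightarrow> (nat \<Rightarrow> nat) \<Rightarrow> nat list \<Rightarrow> real" where
  "word_freq n x v = (\<Sum>i=1..n. of_bool (word_prefix (length v) ((shift ^^ i) x) = v)) / real n"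

definition vstat :: "nat \<Rightarrow> ((nat \<Rightarrow> nat \<Rightarrow> nat) \<Rightarrow> real) \<Rightarrow> nat \<Rightarrow> (nat \<Rightarrow> nat) \<Rightarrow> real" where
  "vstat r \<phi> n x = (1 / real n ^ r) *
     (\<Sum>i\<in>PiE {..<r} (\<lambda>_. {1..n}). \<phi> (\<lambda>j\<in>{..<r}. (shift ^^ i j) x))"

lemma V_Phi_apply: "blinfun_apply (V_Phi r \<Phi> n x) w = vstat r (\<lambda>a. blinfun_apply (\<Phi> a) w) n x"
  by (simp add: V_Phi_def vstat_def blinfun.scaleR_left blinfun.sum_left)

text \<open>Expanding the product of \<open>r\<close> sums yields a sum over index tuples. For each
  tuple exactly one \<open>q\<close> in \<open>Q\<close> agrees with the words seen there. Thus the
  average of a locally constant kernel is a polynomial in the frequencies.\<close>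

lemma sum_prod_word_freq:
  fixes r p m :: nat
  assumes x: "x \<in> Sigma_m m"
  defines "Q \<equiv> PiE {..<r} (\<lambda>_. {u. set u \<subseteq> {..<m} \<and> length u = p})"
  shows "(\<Sum>q\<in>Q. g q * (\<Prod>j<r. word_freq n x (q j))) =
    (1 / real n ^ r) *
      (\<Sum>i\<in>PiE {..<r} (\<lambda>_. {1..n}). g (\<lambda>j\<in>{..<r}. word_prefix p ((shift ^^ i j) x)))"
proof -
  define I where "I = PiE {..<r} (\<lambda>_. {1..n})"
  have finQ: "finite Q" by (auto simp: Q_def intro!: finite_PiE finite_lists_length_eq)
  have "(\<Sum>q\<in>Q. g q * (\<Prod>j<r. word_freq n x (q j))) =
      (1 / real n ^ r) * (\<Sum>q\<in>Q. g q * (\<Sum>i\<in>I. of_bool (\<forall>j<r. word_prefix p ((shift ^^ i j) x) = q j)))"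
    unfolding sum_distrib_left
  proof (rule sum.cong[OF refl])
    fix q assume q: "q \<in> Q"
    have "(\<Prod>j<r. word_freq n x (q j)) =
        (\<Prod>j<r. \<Sum>i=1..n. of_bool (word_prefix p ((shift ^^ i) x) = q j)) / real n ^ r"
      using q by (simp add: word_freq_def prod_dividef Q_def PiE_iff)
    also have "(\<Prod>j<r. \<Sum>i=1..n. of_bool (word_prefix p ((shift ^^ i) x) = q j)) =
        (\<Sum>i\<in>I. \<Prod>j<r. of_bool (word_prefix p ((shift ^^ i j) x) = q j) :: real)"
      unfolding I_def by (rule prod_sum_PiE) auto
    also have "\<dots> = (\<Sum>i\<in>I. of_bool (\<forall>j<r. word_prefix p ((shift ^^ i j) x) = q j))"
      by (intro sum.cong refl) (auto simp: of_bool_def prod_zero_iff)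
    finally show "g q * (\<Prod>j<r. word_freq n x (q j)) = (\<Sum>i\<in>I. 1 / real n ^ r *
        (g q * of_bool (\<forall>j<r. word_prefix p ((shift ^^ i j) x) = q j)))"
      by (simp add: sum_distrib_left sum_divide_distrib)
  qed
  also have "(\<Sum>q\<in>Q. g q * (\<Sum>i\<in>I. of_bool (\<forall>j<r. word_prefix p ((shift ^^ i j) x) = q j))) =
      (\<Sum>i\<in>I. \<Sum>q\<in>Q. g q * of_bool (\<forall>j<r. word_prefix p ((shift ^^ i j) x) = q j))"
    by (subst sum.swap) (simp add: sum_distrib_left)
  also have "\<dots> = (\<Sum>i\<in>I. g (\<lambda>j\<in>{..<r}. word_prefix p ((shift ^^ i j) x)))"
  proof (rule sum.cong[OF refl])
    fix i
    let ?q = "\<lambda>j\<in>{..<r}. word_prefix p ((shift ^^ i j) x)"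
    have "?q \<in> Q"
      using x by (auto simp: Q_def word_prefix_def funpow_shift Sigma_m_def)
    moreover have "(\<forall>j<r. word_prefix p ((shift ^^ i j) x) = q j) \<longleftrightarrow> q = ?q" if "q \<in> Q" for q
      using that by (auto simp: Q_def PiE_iff extensional_def fun_eq_iff)
    ultimately show "(\<Sum>q\<in>Q. g q * of_bool (\<forall>j<r. word_prefix p ((shift ^^ i j) x) = q j)) = g ?q"
      using finQ by (simp add: of_bool_def if_distrib cong: sum.cong if_cong)
  qed
  finally show ?thesis by (simp add: I_def)
qed

text \<open>Replacing each shifted point by a padded copy of its first \<open>p\<close> symbols
  changes the kernel by at most \<open>e\<close>, by uniform continuity, and averaging preserves
  this bound. The new average is a polynomial in finitely many frequencies.\<close>

lemma vstat_approx:
  assumes m: "m > 0" and cont: "continuous_map (shift_power_space m r) euclideanreal \<phi>" and "0 < e"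
  obtains G :: "(nat list \<Rightarrow> real) \<Rightarrow> real" where "continuous_on UNIV G"
    "\<And>n x. n > 0 \<Longrightarrow> x \<in> Sigma_m m \<Longrightarrow> \<bar>vstat r \<phi> n x - G (word_freq n x)\<bar> \<le> e"
proof -
  obtain p where p: "\<And>a b. a \<in> topspace (shift_power_space m r) \<Longrightarrow> b \<in> power_cylinder m r p a \<Longrightarrow>
      \<bar>\<phi> a - \<phi> b\<bar> < e"
    using shift_power_uniformly_continuous[OF cont \<open>0 < e\<close>] by metis
  \<comment> \<open>Words are padded with the symbol 0, which is admissible since
    \<open>m > 0\<close>.\<close>
  define rep :: "nat list \<Rightarrow> nat \<Rightarrow> nat" where "rep u = (\<lambda>t. if t < length u then u ! t else 0)" for u
  define g where "g q = \<phi> (\<lambda>j\<in>{..<r}. rep (q j))" for q :: "nat \<Rightarrow> nat list"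
  define Q where "Q = PiE {..<r} (\<lambda>_. {u. set u \<subseteq> {..<m} \<and> length u = p})"
  define G where "G \<nu> = (\<Sum>q\<in>Q. g q * (\<Prod>j<r. \<nu> (q j)))" for \<nu> :: "nat list \<Rightarrow> real"
  show ?thesis
  proof (rule that)
    show "continuous_on UNIV G" unfolding G_def by (intro continuous_intros continuous_on_product_coordinates)
    fix n x assume n: "(n::nat) > 0" and x: "x \<in> Sigma_m m"
    define I where "I = PiE {..<r} (\<lambda>_. {1..n})"
    define a where "a i = (\<lambda>j\<in>{..<r}. (shift ^^ i j) x)" for i :: "nat \<Rightarrow> nat"
    define b where "b i = (\<lambda>j\<in>{..<r}. rep (word_prefix p ((shift ^^ i j) x)))" for i :: "nat \<Rightarrow> nat"
    have ab: "\<bar>\<phi> (a i) - \<phi> (b i)\<bar> \<le> e" for i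
    proof -
      have "a i \<in> topspace (shift_power_space m r)"
        using x by (auto simp: a_def topspace_shift_power_space funpow_shift_in_Sigma_m)
      moreover have "b i \<in> power_cylinder m r p (a i)"
        using x m by (auto simp: a_def b_def power_cylinder_def topspace_shift_power_space rep_def
            Sigma_m_def word_prefix_def funpow_shift)
      ultimately show ?thesis using p less_imp_le by blast
    qed
    have "G (word_freq n x) = (1 / real n ^ r) * (\<Sum>i\<in>I. \<phi> (b i))"
      unfolding G_def Q_def I_def sum_prod_word_freq[OF x]
      by (simp add: g_def b_def cong: restrict_cong)
    then have "vstat r \<phi> n x - G (word_freq n x) = (1 / real n ^ r) * (\<Sum>i\<in>I. \<phi> (a i) - \<phi> (b i))"
      by (simp add: vstat_def I_def a_def sum_subtractf right_diff_distrib)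
    also have "\<bar>\<dots>\<bar> \<le> (1 / real n ^ r) * (\<Sum>i\<in>I. e)"
      unfolding abs_mult
      by (intro mult_mono order.trans[OF sum_abs] sum_mono ab) (auto simp: sum_nonneg)
    also have "\<dots> = e" using n by (simp add: I_def card_PiE)
    finally show "\<bar>vstat r \<phi> n x - G (word_freq n x)\<bar> \<le> e" .
  qed
qed

text \<open>Two approximation errors and two oscillations of \<open>G\<close>, each worth
  \<open>e / 4\<close>, add up to less than \<open>e\<close>. The lengths \<open>n\<close> and
  \<open>n'\<close> are independent, so one finite word can control all long averages of another
  point.\<close>

lemma vstat_determined_by_word_freq:
  assumes m: "m > 0" and cont: "continuous_map (shift_power_space m r) euclideanreal \<phi>" and "0 < e"
  obtains N where "open N" "\<nu> \<in> N"
    "\<forall>n>0. \<forall>n'>0. \<forall>x\<in>Sigma_m m. \<forall>x'\<in>Sigma_m m.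
      word_freq n x \<in> N \<longrightarrow> word_freq n' x' \<in> N \<longrightarrow> \<bar>vstat r \<phi> n x - vstat r \<phi> n' x'\<bar> < e"
proof -
  have "0 < e / 4" using \<open>0 < e\<close> by simp
  then obtain G where G: "continuous_on UNIV G"
    "\<And>n x. n > 0 \<Longrightarrow> x \<in> Sigma_m m \<Longrightarrow> \<bar>vstat r \<phi> n x - G (word_freq n x)\<bar> \<le> e / 4"
    using vstat_approx[OF m cont] by metis
  show ?thesis
  proof (rule that)
    show "open (G -` ball (G \<nu>) (e / 4))"
      using G(1) by (intro open_vimage) auto
    show "\<nu> \<in> G -` ball (G \<nu>) (e / 4)" using \<open>0 < e\<close> by simp
    have "\<bar>vstat r \<phi> n x - vstat r \<phi> n' x'\<bar> < e"
      if "n > 0" "n' > 0" "x \<in> Sigma_m m" "x' \<in> Sigma_m m"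
        "word_freq n x \<in> G -` ball (G \<nu>) (e / 4)" "word_freq n' x' \<in> G -` ball (G \<nu>) (e / 4)"
      for n n' x x'
    proof -
      have "\<bar>G \<nu> - G (word_freq n x)\<bar> < e / 4" "\<bar>G \<nu> - G (word_freq n' x')\<bar> < e / 4"
        "\<bar>vstat r \<phi> n x - G (word_freq n x)\<bar> \<le> e / 4"
        "\<bar>vstat r \<phi> n' x' - G (word_freq n' x')\<bar> \<le> e / 4"
        using that G(2) by (auto simp: dist_real_def)
      then show ?thesis
        unfolding abs_less_iff abs_le_iff by (intro conjI) linarith+
    qed
    then show "\<forall>n>0. \<forall>n'>0. \<forall>x\<in>Sigma_m m. \<forall>x'\<in>Sigma_m m.
        word_freq n x \<in> G -` ball (G \<nu>) (e / 4) \<longrightarrow> word_freq n' x' \<in> G -` ball (G \<nu>) (e / 4) \<longrightarrow>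
        \<bar>vstat r \<phi> n x - vstat r \<phi> n' x'\<bar> < e"
      by blast
  qed
qed

section \<open>Concatenation of blocks\<close>

text \<open>A window of length \<open>length v\<close> starting at \<open>i\<close> leaves the first
  \<open>n\<close> coordinates only if \<open>n < i + length v\<close>, which holds for at most
  \<open>length v\<close> values of \<open>i\<close> in \<open>{1..n}\<close>.\<close>

lemma word_freq_prefix_close:
  assumes "\<And>t. t < n \<Longrightarrow> x t = y t" "n > 0"
  shows "\<bar>word_freq n x v - word_freq n y v\<bar> \<le> length v / n"
proof -
  define b where "b z i = (of_bool (word_prefix (length v) ((shift ^^ i) z) = v) :: real)" for z i
  have "\<bar>(\<Sum>i=1..n. b x i) - (\<Sum>i=1..n. b y i)\<bar> \<le> (\<Sum>i=1..n. \<bar>b x i - b y i\<bar>)"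
    by (simp add: sum_abs flip: sum_subtractf)
  also have "\<dots> \<le> (\<Sum>i=1..n. of_bool (n < i + length v))"
  proof (rule sum_mono)
    fix i
    show "\<bar>b x i - b y i\<bar> \<le> of_bool (n < i + length v)"
    proof (cases "n < i + length v")
      case False
      then have "word_prefix (length v) ((shift ^^ i) x) = word_prefix (length v) ((shift ^^ i) y)"
        using assms(1) by (simp add: word_prefix_eq_iff funpow_shift)
      then show ?thesis by (simp add: b_def)
    qed (simp add: b_def)
  qed
  also have "\<dots> = card {i \<in> {1..n}. n < i + length v}"
    by (simp add: of_bool_def sum.If_cases Int_def)
  also have "\<dots> \<le> card {n - length v<..n}"
    by (intro of_nat_mono card_mono) auto
  also have "\<dots> \<le> length v" by simp
  finally show ?thesis
    using \<open>n > 0\<close> by (simp add: word_freq_def b_def divide_right_mono flip: diff_divide_distrib)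
qed

section \<open>Concatenated points and their averages\<close>

definition offset :: "(nat \<Rightarrow> nat) \<Rightarrow> nat \<Rightarrow> nat" where
  "offset len j = (\<Sum>i<j. len i)"

lemma offset_Suc: "offset len (Suc j) = offset len j + len j"
  by (simp add: offset_def)

lemma offset_mono: "i \<le> j \<Longrightarrow> offset len i \<le> offset len j"
  unfolding offset_def by (intro sum_mono2) auto

lemma le_offset:
  assumes "\<And>i. len i > 0"
  shows "j \<le> offset len j"
proof (induction j)
  case (Suc j)
  then show ?case using assms[of j] by (simp add: offset_Suc)
qed simp

definition block_index :: "(nat \<Rightarrow> nat) \<Rightarrow> nat \<Rightarrow> nat" where
  "block_index len t = (LEAST j. t < offset len (Suc j))"

lemma block_index_bounds:
  assumes "\<And>i. len i > 0"
  shows "offset len (block_index len t) \<le> t" "t < offset len (Suc (block_index len t))"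
proof -
  have "t < offset len (Suc t)" using le_offset[of len "Suc t"] assms by simp
  then show "t < offset len (Suc (block_index len t))"
    unfolding block_index_def by (rule LeastI)
  show "offset len (block_index len t) \<le> t"
  proof (cases "block_index len t")
    case 0
    then show ?thesis by (simp add: offset_def)
  next
    case (Suc i)
    then show ?thesis
      using not_less_Least[of i "\<lambda>j. t < offset len (Suc j)"] by (simp add: block_index_def)
  qed
qed

lemma block_index_eqI:
  assumes "offset len j \<le> t" "t < offset len (Suc j)"
  shows "block_index len t = j"
  unfolding block_index_def
proof (rule Least_equality)
  fix i assume "t < offset len (Suc i)"
  then show "j \<le> i" using assms(1) offset_mono[of "Suc i" j len] by (meson leD le_less_trans not_less_eq_eq)
qed (fact assms)

text \<open>Only the first \<open>len j\<close> symbols of \<open>y j\<close> enter. Blocks are kept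
  as infinite sequences so that \<open>word_freq\<close> applies to them directly.\<close>

definition block_concat :: "(nat \<Rightarrow> nat) \<Rightarrow> (nat \<Rightarrow> nat \<Rightarrow> nat) \<Rightarrow> nat \<Rightarrow> nat" where
  "block_concat len y t = y (block_index len t) (t - offset len (block_index len t))"

lemma block_concat_apply:
  "s < len j \<Longrightarrow> block_concat len y (offset len j + s) = y j s"
  using block_index_eqI[of len j "offset len j + s"] by (simp add: block_concat_def offset_Suc)

lemma block_concat_in_Sigma_m: "(\<And>i. y i \<in> Sigma_m m) \<Longrightarrow> block_concat len y \<in> Sigma_m m"
  by (auto simp: block_concat_def Sigma_m_def)

text \<open>Up to time \<open>n\<close> there are three contributions: a fixed initial segment,
  complete blocks with small averages, and one unfinished block, which is short compared with all
  that precedes it.\<close>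

lemma block_averages_tendsto_0:
  fixes a :: "nat \<Rightarrow> real"
  assumes len: "\<And>j. len j > 0"
    and bdd: "\<And>t. \<bar>a t\<bar> \<le> B"
    and blocks: "(\<lambda>j. (\<Sum>s<len j. a (offset len j + s)) / len j) \<longlonglongrightarrow> 0"
    and small: "(\<lambda>j. len j / offset len j) \<longlonglongrightarrow> 0"
  shows "(\<lambda>n. (\<Sum>t<n. a t) / n) \<longlonglongrightarrow> 0"
proof (rule LIMSEQ_I)
  fix e :: real assume "0 < e"
  have B: "0 \<le> B" using bdd[of 0] by linarith
  \<comment> \<open>The complete blocks cost \<open>d\<close> and the unfinished one
    \<open>B * d\<close> per unit of length, together \<open>e / 2\<close>; the other half is left
    for the initial segment.\<close>
  define d where "d = e / (2 * (B + 1))"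
  have d: "0 < d" "d * (B + 1) = e / 2" using \<open>0 < e\<close> B by (auto simp: d_def field_simps)
  have "eventually (\<lambda>j. \<bar>(\<Sum>s<len j. a (offset len j + s)) / len j\<bar> < d \<and> len j / offset len j < d \<and> j > 0) sequentially"
    using order_tendstoD(2)[OF tendsto_rabs_zero[OF blocks] d(1)] order_tendstoD(2)[OF small d(1)]
      eventually_gt_at_top[of 0] by eventually_elim auto
  then obtain J where J: "\<And>j. j \<ge> J \<Longrightarrow> \<bar>(\<Sum>s<len j. a (offset len j + s)) / len j\<bar> < d"
    "\<And>j. j \<ge> J \<Longrightarrow> len j / offset len j < d" "\<And>j. j \<ge> J \<Longrightarrow> j > 0"
    by (auto simp: eventually_sequentially)
  define C where "C = \<bar>\<Sum>t<offset len J. a t\<bar>"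
  have block: "\<bar>\<Sum>s<len j. a (offset len j + s)\<bar> \<le> d * len j" if "j \<ge> J" for j
    using J(1)[OF that] len[of j] by (simp add: divide_simps abs_divide)
  have short: "len j \<le> d * offset len j" if "j \<ge> J" for j
    using J(2,3)[OF that] le_offset[of len j] len by (simp add: divide_simps split: if_splits)
  have split: "(\<Sum>t<p + q. a t) = (\<Sum>t<p. a t) + (\<Sum>s<q. a (p + s))" for p q
    by (induction q) simp_all
  have upto: "\<bar>\<Sum>t<offset len j. a t\<bar> \<le> C + d * offset len j" if "j \<ge> J" for j
    using that
  proof (induction j rule: dec_induct)
    case base
    then show ?case using d by (simp add: C_def)
  next
    case (step j)
    have "(\<Sum>t<offset len (Suc j). a t) = (\<Sum>t<offset len j. a t) + (\<Sum>s<len j. a (offset len j + s))"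
      unfolding offset_Suc by (rule split)
    then show ?case using step block[of j] by (simp add: offset_Suc algebra_simps)
  qed
  obtain n0 where n0: "real n0 > 2 * C / e" using reals_Archimedean2 by blast
  show "\<exists>n0. \<forall>n\<ge>n0. norm ((\<Sum>t<n. a t) / n - 0) < e"
  proof (intro exI allI impI)
    fix n assume n: "n \<ge> max (max 1 n0) (offset len J)"
    define j where "j = block_index len n"
    have j: "offset len j \<le> n" "n < offset len (Suc j)"
      using block_index_bounds[of len] len by (auto simp: j_def)
    have "j \<ge> J"
    proof (rule ccontr)
      assume "\<not> j \<ge> J"
      then show False using offset_mono[of "Suc j" J len] j n by simp
    qed
    have "\<bar>\<Sum>t\<in>{offset len j..<n}. a t\<bar> \<le> (\<Sum>t\<in>{offset len j..<n}. B)"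
      by (intro order.trans[OF sum_abs] sum_mono bdd)
    also have "\<dots> \<le> B * len j"
      using j B by (simp add: offset_Suc mult.commute mult_left_mono)
    also have "\<dots> \<le> B * (d * offset len j)"
      using short[OF \<open>j \<ge> J\<close>] B by (intro mult_left_mono) auto
    finally have tail: "\<bar>\<Sum>t\<in>{offset len j..<n}. a t\<bar> \<le> B * (d * offset len j)" .
    have "(\<Sum>t<n. a t) = (\<Sum>t<offset len j. a t) + (\<Sum>t\<in>{offset len j..<n}. a t)"
      using j(1) by (simp add: lessThan_atLeast0 sum.atLeastLessThan_concat)
    then have "\<bar>\<Sum>t<n. a t\<bar> \<le> C + d * (B + 1) * offset len j"
      using tail upto[OF \<open>j \<ge> J\<close>] by (simp add: algebra_simps)
    also have "\<dots> \<le> C + e / 2 * n"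
      unfolding d(2) using j(1) \<open>0 < e\<close> by (intro add_left_mono mult_left_mono) auto
    also have "C < e / 2 * n"
      using n0 n \<open>0 < e\<close> by (simp add: field_simps) (smt (verit) mult_left_mono of_nat_le_iff)
    finally have "\<bar>\<Sum>t<n. a t\<bar> < e * n" by simp
    then show "norm ((\<Sum>t<n. a t) / n - 0) < e"
      using n by (simp add: field_simps)
  qed
qed

text \<open>The index \<open>k\<close> becomes available only once \<open>j\<close> reaches the
  square of \<open>n k\<close>, so eventually \<open>n (\<kappa> j)\<close> is at most the square
  root of \<open>j\<close>.\<close>

lemma obtain_slow_sequence:
  fixes n :: "nat \<Rightarrow> nat"
  obtains \<kappa> :: "nat \<Rightarrow> nat" where "filterlim \<kappa> at_top sequentially" "(\<lambda>j. real (n (\<kappa> j)) / real j) \<longlonglongrightarrow> 0"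
proof -
  \<comment> \<open>The bound \<open>k \<le> j\<close> makes the set finite and the unconditional
    element 0 makes it nonempty. The exception for 0 is harmless because \<open>\<kappa>\<close>
    eventually exceeds it.\<close>
  define A where "A j = {k. k \<le> j \<and> (k = 0 \<or> n k ^ 2 \<le> j)}" for j
  define \<kappa> where "\<kappa> j = Max (A j)" for j
  have A: "finite (A j)" "0 \<in> A j" for j
    by (auto simp: A_def)
  have \<kappa>_in: "\<kappa> j \<in> A j" for j
    using A[of j] unfolding \<kappa>_def by (intro Max_in) auto
  have \<kappa>_ge: "\<kappa> j \<ge> k" if "j \<ge> max k (n k ^ 2)" for j k
    using that A(1)[of j] unfolding \<kappa>_def by (intro Max_ge) (auto simp: A_def)
  then have lim: "filterlim \<kappa> at_top sequentially"
    unfolding filterlim_at_top eventually_sequentially by blast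
  moreover have "(\<lambda>j. real (n (\<kappa> j)) / real j) \<longlonglongrightarrow> 0"
  proof (rule tendsto_sandwich[OF _ _ tendsto_const])
    show "eventually (\<lambda>j. real (n (\<kappa> j)) / real j \<le> 1 / sqrt j) sequentially"
      using lim[unfolded filterlim_at_top, rule_format, of 1] eventually_gt_at_top[of 0]
    proof eventually_elim
      case (elim j)
      then have "real (n (\<kappa> j)) ^ 2 \<le> real j"
        using \<kappa>_in[of j] by (auto simp: A_def simp flip: of_nat_power)
      then have "real (n (\<kappa> j)) \<le> sqrt j" by (rule real_le_rsqrt)
      then have "real (n (\<kappa> j)) / real j \<le> sqrt j / real j" by (rule divide_right_mono) simp
      also have "sqrt j / real j = 1 / sqrt j" by (simp add: sqrt_divide_self_eq inverse_eq_divide)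
      finally show ?case .
    qed
    show "(\<lambda>j. 1 / sqrt (real j)) \<longlonglongrightarrow> 0"
      by (intro tendsto_divide_0[OF tendsto_const] filterlim_compose[OF filterlim_at_top_imp_at_infinity[OF sqrt_at_top]] filterlim_real_sequentially)
  qed auto
  ultimately show ?thesis using that by blast
qed

text \<open>Countable subadditivity for unordered sums, by exhausting the index set with finite sets
  and using continuity from below.\<close>

lemma emeasure_UN_le_infsum:
  assumes "countable C" "\<And>c. c \<in> C \<Longrightarrow> A c \<in> sets M"
  shows "emeasure M (\<Union>c\<in>C. A c) \<le> (\<Sum>\<^sub>\<infinity>c\<in>C. emeasure M (A c))"
proof (cases "C = {}")
  case False
  define F where "F n = from_nat_into C ` {..n}" for n
  have F: "finite (F n)" "F n \<subseteq> C" for n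
    using from_nat_into[OF False] by (auto simp: F_def)
  have "(\<Union>c\<in>C. A c) = (\<Union>n. \<Union>c\<in>F n. A c)"
    using F(2) from_nat_into_surj[OF assms(1)] by (fastforce simp: F_def)
  also have "emeasure M (\<Union>n. \<Union>c\<in>F n. A c) = (SUP n. emeasure M (\<Union>c\<in>F n. A c))"
  proof (rule SUP_emeasure_incseq[symmetric])
    have "F k \<subseteq> F n" if "k \<le> n" for k n
      using that by (auto simp: F_def)
    then show "incseq (\<lambda>n. \<Union>c\<in>F n. A c)" unfolding incseq_def by blast
  qed (use F assms(2) in \<open>auto intro!: sets.finite_UN\<close>)
  also have "\<dots> \<le> (\<Sum>\<^sub>\<infinity>c\<in>C. emeasure M (A c))"
  proof (rule SUP_least)
    fix n
    have "emeasure M (\<Union>c\<in>F n. A c) \<le> (\<Sum>c\<in>F n. emeasure M (A c))"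
      using F assms(2) by (intro emeasure_subadditive_finite) auto
    also have "\<dots> \<le> (\<Sum>\<^sub>\<infinity>c\<in>C. emeasure M (A c))"
      using F by (subst nonneg_infsum_complete) (auto intro!: SUP_upper)
    finally show "emeasure M (\<Union>c\<in>F n. A c) \<le> (\<Sum>\<^sub>\<infinity>c\<in>C. emeasure M (A c))" .
  qed
  finally show ?thesis .
qed simp

section \<open>Entropy of the set of points with prescribed frequencies\<close>

lemma tendsto_fun_coordinate:
  fixes f :: "'c \<Rightarrow> 'a \<Rightarrow> 'b::topological_space"
  assumes "(f \<longlongrightarrow> l) F"
  shows "((\<lambda>c. f c i) \<longlongrightarrow> l i) F"
  using continuous_on_tendsto_compose[OF continuous_on_product_coordinates assms] by simp

lemma tendsto_fun_coordinatewiseI: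
  fixes f :: "'c \<Rightarrow> 'a \<Rightarrow> 'b::topological_space"
  assumes "\<And>i. ((\<lambda>c. f c i) \<longlongrightarrow> l i) F"
  shows "(f \<longlongrightarrow> l) F"
proof -
  have "limitin (product_topology (\<lambda>_. euclidean) UNIV) f l F"
    using assms by (simp add: limitin_componentwise)
  then show ?thesis by (simp add: euclidean_product_topology)
qed

text \<open>The averaging lemma is applied to the centred indicators of occurrences of
  \<open>v\<close>. On block \<open>j\<close> the frequencies of the concatenation and of
  \<open>y j\<close> differ only through windows that overrun the block, hence by at most
  \<open>length v / len j\<close>.\<close>

lemma word_freq_block_concat_tendsto:
  assumes len: "\<And>j. len j > 0" and large: "filterlim len at_top sequentially"
    and small: "(\<lambda>j. len j / offset len j) \<longlonglongrightarrow> 0"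
    and y: "(\<lambda>j. word_freq (len j) (y j)) \<longlonglongrightarrow> \<nu>"
  shows "(\<lambda>n. word_freq n (block_concat len y)) \<longlonglongrightarrow> \<nu>"
proof (rule tendsto_fun_coordinatewiseI)
  fix v
  define x where "x = block_concat len y"
  \<comment> \<open>\<open>Suc t\<close> translates sums starting at 0 into the sums starting at 1
    of \<open>word_freq\<close>.\<close>
  define b where "b t = (of_bool (word_prefix (length v) ((shift ^^ Suc t) x) = v) :: real)" for t
  have freq: "word_freq n ((shift ^^ k) x) v = (\<Sum>s<n. b (k + s)) / n" for n k
  proof -
    have "(\<Sum>i=1..n. of_bool (word_prefix (length v) ((shift ^^ i) ((shift ^^ k) x)) = v))
        = (\<Sum>s<n. b (k + s))"
      by (rule sum.reindex_bij_witness[of _ Suc "\<lambda>i. i - 1"])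
        (auto simp: b_def funpow_shift add_ac)
    then show ?thesis by (simp add: word_freq_def)
  qed
  have avg: "(\<Sum>s<n. b (k + s) - \<nu> v) / n = word_freq n ((shift ^^ k) x) v - \<nu> v" if "n > 0" for n k
    using that by (simp add: freq sum_subtractf diff_divide_distrib)
  have "(\<lambda>n. (\<Sum>t<n. b t - \<nu> v) / n) \<longlonglongrightarrow> 0"
  proof (rule block_averages_tendsto_0[OF len])
    show "\<bar>b t - \<nu> v\<bar> \<le> 1 + \<bar>\<nu> v\<bar>" for t by (auto simp: b_def)
    have "(\<lambda>j. word_freq (len j) (y j) v - \<nu> v) \<longlonglongrightarrow> 0"
      using tendsto_fun_coordinate[OF y, of v] by (simp add: LIM_zero)
    moreover have "(\<lambda>j. word_freq (len j) ((shift ^^ offset len j) x) v - word_freq (len j) (y j) v) \<longlonglongrightarrow> 0"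
    proof (rule Lim_null_comparison)
      show "eventually (\<lambda>j. norm (word_freq (len j) ((shift ^^ offset len j) x) v - word_freq (len j) (y j) v)
          \<le> length v / len j) sequentially"
        using word_freq_prefix_close[OF _ len] block_concat_apply
        by (intro always_eventually allI) (simp add: funpow_shift x_def)
      show "(\<lambda>j. length v / len j) \<longlonglongrightarrow> 0"
        by (intro tendsto_divide_0[OF tendsto_const] filterlim_at_top_imp_at_infinity
            filterlim_compose[OF filterlim_real_sequentially large])
    qed
    ultimately have "(\<lambda>j. (word_freq (len j) (y j) v - \<nu> v) + (word_freq (len j) ((shift ^^ offset len j) x) v
        - word_freq (len j) (y j) v)) \<longlonglongrightarrow> 0 + 0"
      by (rule tendsto_add)
    then show "(\<lambda>j. (\<Sum>s<len j. b (offset len j + s) - \<nu> v) / len j) \<longlonglongrightarrow> 0"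
      using len by (simp add: avg)
  qed (fact small)
  moreover have "eventually (\<lambda>n. (\<Sum>t<n. b t - \<nu> v) / n = word_freq n x v - \<nu> v) sequentially"
    using eventually_gt_at_top[of 0]
  proof eventually_elim
    case (elim n)
    then show ?case using avg[of n 0] by simp
  qed
  ultimately have "(\<lambda>n. word_freq n x v - \<nu> v) \<longlonglongrightarrow> 0"
    by (rule Lim_transform_eventually)
  then show "(\<lambda>n. word_freq n (block_concat len y) v) \<longlonglongrightarrow> \<nu> v"
    by (simp add: LIM_zero_iff x_def)
qed

text \<open>Mass distribution principle for the image of the uniform product measure on block sequences.\<close>

lemma htop_block_concat_ge:
  fixes c c' :: real
  assumes len: "\<And>j. len j > 0"
    and small: "(\<lambda>j. len j / offset len j) \<longlonglongrightarrow> 0"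
    and D: "\<And>j. finite (D j)" "\<And>j. inj_on (word_prefix (len j)) (D j)"
    and card: "\<And>j. exp (c' * len j) \<le> card (D j)"
    and c: "0 < c" "c < c'"
  shows "ereal c \<le> htop m (block_concat len ` (PiE UNIV D))"
proof -
  define M where "M j = uniform_count_measure (D j)" for j
  define P where "P = PiM UNIV M"
  have D_ne: "D j \<noteq> {}" for j
    using card[of j] by (auto simp: not_le)
  have prob: "prob_space (M j)" for j
    unfolding M_def using D(1) D_ne by (rule prob_space_uniform_count_measure)
  then have "prob_space P" unfolding P_def by (rule prob_space_PiM)
  have space_P: "space P = PiE UNIV D"
    by (simp add: P_def M_def space_PiM space_uniform_count_measure)
  define cyl where "cyl \<omega> j = {\<omega>' \<in> space P. \<forall>i<j. \<omega>' i = \<omega> i}" for \<omega> j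
  have cyl: "cyl \<omega> j \<in> sets P" "emeasure P (cyl \<omega> j) \<le> ennreal (exp (- (c' * offset len j)))"
    if "\<omega> \<in> space P" for \<omega> j
  proof -
    have eq: "cyl \<omega> j = prod_emb UNIV M {..<j} (PiE {..<j} (\<lambda>i. {\<omega> i}))"
      by (auto simp: cyl_def prod_emb_def P_def space_PiM restrict_def PiE_def extensional_def Pi_def)
    have \<omega>: "\<omega> i \<in> D i" for i using that by (auto simp: space_P)
    then have sets: "{\<omega> i} \<in> sets (M i)" for i by (simp add: M_def sets_uniform_count_measure)
    show "cyl \<omega> j \<in> sets P" unfolding eq P_def using sets by (intro sets_PiM_I) auto
    have "emeasure P (cyl \<omega> j) = (\<Prod>i<j. emeasure (M i) {\<omega> i})"
      unfolding eq P_def using sets by (intro emeasure_PiM_emb prob) auto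
    also have "\<dots> = (\<Prod>i<j. ennreal (1 / card (D i)))"
      using \<omega> D(1) by (simp add: M_def emeasure_uniform_count_measure)
    also have "\<dots> = ennreal (\<Prod>i<j. 1 / card (D i))"
      by (simp add: prod_ennreal)
    also have "\<dots> \<le> ennreal (\<Prod>i<j. exp (- (c' * len i)))"
    proof (intro prod_mono conjI ennreal_leI)
      fix i
      have "1 / real (card (D i)) \<le> 1 / exp (c' * len i)"
        using card[of i] by (intro divide_left_mono mult_pos_pos) (auto simp: card_gt_0_iff D D_ne)
      then show "1 / real (card (D i)) \<le> exp (- (c' * len i))" by (simp add: exp_minus field_simps)
    qed auto
    also have "(\<Prod>i<j. exp (- (c' * len i))) = exp (- (c' * offset len j))"
      by (simp add: offset_def sum_negf sum_distrib_left flip: exp_sum)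
    finally show "emeasure P (cyl \<omega> j) \<le> ennreal (exp (- (c' * offset len j)))" .
  qed
  \<comment> \<open>Consecutive offsets have ratio tending to 1, so the gap between \<open>c\<close>
    and \<open>c'\<close> eventually pays for rounding an order up to the end of its block.\<close>
  have "0 < c' / c - 1" using c by (simp add: field_simps)
  from order_tendstoD(2)[OF small this] eventually_gt_at_top[of 0]
  have "eventually (\<lambda>j. c * (offset len j + len j) \<le> c' * offset len j) sequentially"
  proof eventually_elim
    case (elim j)
    then have "real (offset len j) > 0" using le_offset[of len j] len by (metis less_le_trans of_nat_0_less_iff)
    then show ?case using elim c by (simp add: field_simps)
  qed
  then obtain J where J: "\<And>j. j \<ge> J \<Longrightarrow> c * (offset len j + len j) \<le> c' * offset len j"
    by (auto simp: eventually_sequentially)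
  show ?thesis
  proof (rule htop_eps_1_geI[where n = "offset len J"])
    fix C assume "countable C"
      and C: "\<And>k x. (k, x) \<in> C \<Longrightarrow> offset len J \<le> k \<and> x \<in> Sigma_m m"
      and cover: "block_concat len ` PiE UNIV D \<subseteq> (\<Union>(k, x)\<in>C. bowen_ball m k x 1)"
    define hit where "hit z = {\<omega> \<in> space P. block_concat len \<omega> \<in> bowen_ball m (fst z) (snd z) 1}" for z
    \<comment> \<open>Instead of measuring \<open>hit z\<close> itself, it is enclosed in a
      measurable cylinder: the first \<open>k\<close> symbols determine every block completed by
      time \<open>k\<close>, since prefixes are injective on each \<open>D i\<close>.\<close>
    have "\<exists>A\<in>sets P. hit z \<subseteq> A \<and>
        emeasure P A \<le> ennreal (exp (- c * fst z))" if "z \<in> C" for z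
    proof (cases "hit z = {}")
      case True
      then show ?thesis by (intro bexI[of _ "{}"]) auto
    next
      case False
      then obtain \<omega> where \<omega>: "\<omega> \<in> space P" "block_concat len \<omega> \<in> bowen_ball m (fst z) (snd z) 1"
        by (auto simp: hit_def)
      define k where "k = fst z"
      define j where "j = block_index len k"
      have j: "offset len j \<le> k" "k < offset len (Suc j)"
        using block_index_bounds[of len] len by (auto simp: j_def)
      have k: "offset len J \<le> k" using C[of "fst z" "snd z"] that by (simp add: k_def)
      have "j \<ge> J"
      proof (rule ccontr)
        assume "\<not> j \<ge> J"
        then show False using offset_mono[of "Suc j" J len] j k by simp
      qed
      have "hit z \<subseteq> cyl \<omega> j"
      proof
        fix \<omega>' assume "\<omega>' \<in> hit z"
        then have \<omega>': "\<omega>' \<in> space P" "block_concat len \<omega>' \<in> bowen_ball m (fst z) (snd z) 1"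
          by (auto simp: hit_def)
        have same: "block_concat len \<omega>' t = block_concat len \<omega> t" if "t < k" for t
        proof -
          have "bowen_dist k (snd z) (block_concat len \<omega>) < 1" "bowen_dist k (snd z) (block_concat len \<omega>') < 1"
            using \<omega>(2) \<omega>' by (auto simp: bowen_ball_def k_def)
          then show ?thesis using bowen_dist_less_1D[OF _ that] by metis
        qed
        have "\<omega>' i = \<omega> i" if "i < j" for i
        proof -
          have "\<omega>' i s = \<omega> i s" if "s < len i" for s
          proof -
            have "offset len i + s < k"
              using that \<open>i < j\<close> offset_mono[of "Suc i" j len] j by (simp add: offset_Suc)
            then show ?thesis using same[of "offset len i + s"] that by (simp add: block_concat_apply)
          qed
          then have "word_prefix (len i) (\<omega>' i) = word_prefix (len i) (\<omega> i)"
            by (simp add: word_prefix_eq_iff)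
          moreover have "\<omega>' i \<in> D i" "\<omega> i \<in> D i" using \<omega> \<omega>' by (auto simp: space_P)
          ultimately show ?thesis using D(2) by (meson inj_onD)
        qed
        then show "\<omega>' \<in> cyl \<omega> j" using \<omega>' by (auto simp: cyl_def)
      qed
      moreover have "emeasure P (cyl \<omega> j) \<le> ennreal (exp (- c * fst z))"
      proof -
        have "c * k \<le> c * (offset len j + len j)"
          using j c by (intro mult_left_mono) (auto simp: offset_Suc)
        also have "\<dots> \<le> c' * offset len j" using J[OF \<open>j \<ge> J\<close>] by simp
        finally have "ennreal (exp (- (c' * offset len j))) \<le> ennreal (exp (- c * fst z))"
          by (intro ennreal_leI) (simp add: k_def)
        then show ?thesis using cyl(2)[OF \<omega>(1), of j] by (rule order.trans[rotated])
      qed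
      ultimately show ?thesis using cyl(1)[OF \<omega>(1)] by blast
    qed
    then obtain A where A: "\<And>z. z \<in> C \<Longrightarrow> A z \<in> sets P"
      "\<And>z. z \<in> C \<Longrightarrow> hit z \<subseteq> A z"
      "\<And>z. z \<in> C \<Longrightarrow> emeasure P (A z) \<le> ennreal (exp (- c * fst z))"
      by metis
    have "space P \<subseteq> (\<Union>z\<in>C. A z)"
    proof
      fix \<omega> assume \<omega>: "\<omega> \<in> space P"
      then have "block_concat len \<omega> \<in> (\<Union>(k, x)\<in>C. bowen_ball m k x 1)"
        using cover space_P by blast
      then obtain z where "z \<in> C" "block_concat len \<omega> \<in> bowen_ball m (fst z) (snd z) 1"
        by (auto simp: case_prod_unfold)
      then have "\<omega> \<in> hit z" using \<omega> by (simp add: hit_def)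
      then show "\<omega> \<in> (\<Union>z\<in>C. A z)" using A(2) \<open>z \<in> C\<close> by blast
    qed
    then have "emeasure P (space P) \<le> emeasure P (\<Union>z\<in>C. A z)"
      using A(1) \<open>countable C\<close> by (intro emeasure_mono sets.countable_UN'') auto
    also have "\<dots> \<le> (\<Sum>\<^sub>\<infinity>z\<in>C. emeasure P (A z))"
      using \<open>countable C\<close> A(1) by (rule emeasure_UN_le_infsum)
    also have "\<dots> \<le> (\<Sum>\<^sub>\<infinity>(k, x)\<in>C. ennreal (exp (- c * k)))"
      using A(3) by (intro infsum_mono nonneg_summable_on_complete) (auto simp: case_prod_unfold)
    finally show "1 \<le> (\<Sum>\<^sub>\<infinity>(k, x)\<in>C. ennreal (exp (- c * real k)))"
      using prob_space.emeasure_space_1[OF \<open>prob_space P\<close>] by simp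
  qed
qed

lemma htop_mono:
  assumes "Z \<subseteq> Z'"
  shows "htop m Z \<le> htop m Z'"
proof -
  have "H_n m s Z \<epsilon> n \<le> H_n m s Z' \<epsilon> n" for s \<epsilon> n
    unfolding H_n_def using assms by (intro INF_superset_mono) auto
  then have "H_s m s Z \<epsilon> \<le> H_s m s Z' \<epsilon>" for s \<epsilon>
    unfolding H_s_def by (intro SUP_mono) auto
  then have zero: "H_s m s Z' \<epsilon> = 0 \<Longrightarrow> H_s m s Z \<epsilon> = 0" for s \<epsilon>
    by (metis le_zero_eq)
  have "htop_eps m Z \<epsilon> \<le> htop_eps m Z' \<epsilon>" for \<epsilon>
    unfolding htop_eps_def by (rule Inf_superset_mono) (use zero in blast)
  then show ?thesis unfolding htop_def by (rule SUP_mono') 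
qed

text \<open>Each neighbourhood in a sequence shrinking to \<open>\<nu>\<close> supplies a length and
  exponentially many words of that length. All concatenations of these words have limit frequency
  \<open>\<nu>\<close>, and independent choices of blocks give the entropy.\<close>

lemma htop_word_freq_tendsto_ge:
  fixes c c' :: real
  assumes many: "\<And>N. open N \<Longrightarrow> \<nu> \<in> N \<Longrightarrow> frequently (\<lambda>n.
      exp (c' * n) \<le> card (word_prefix n ` {x \<in> Sigma_m m. word_freq n x \<in> N})) sequentially"
    and c: "0 < c" "c < c'"
  shows "ereal c \<le> htop m {x \<in> Sigma_m m. (\<lambda>n. word_freq n x) \<longlonglongrightarrow> \<nu>}"
proof -
  \<comment> \<open>There are countably many words, so the space of frequency functions is first
    countable.\<close>
  obtain A where A: "\<And>i. open (A i)" "\<And>i. \<nu> \<in> A i"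
    "\<And>S. open S \<Longrightarrow> \<nu> \<in> S \<Longrightarrow> eventually (\<lambda>i. A i \<subseteq> S) sequentially"
    using countable_basis_at_decseq[of \<nu>] by metis
  define good where "good k n D \<longleftrightarrow> n > k \<and> D \<subseteq> {x \<in> Sigma_m m. word_freq n x \<in> A k} \<and> finite D \<and>
      inj_on (word_prefix n) D \<and> exp (c' * n) \<le> card D" for k n D
  have "\<exists>n D. good k n D" for k
  proof -
    obtain n where n: "n > k"
      "exp (c' * n) \<le> card (word_prefix n ` {x \<in> Sigma_m m. word_freq n x \<in> A k})"
      using many[OF A(1,2), of k] unfolding frequently_sequentially by (meson Suc_le_lessD)
    obtain D where D: "D \<subseteq> {x \<in> Sigma_m m. word_freq n x \<in> A k}" "finite D" "inj_on (word_prefix n) D"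
      "word_prefix n ` D = word_prefix n ` {x \<in> Sigma_m m. word_freq n x \<in> A k}"
      by (rule obtain_prefix_representatives[of "{x \<in> Sigma_m m. word_freq n x \<in> A k}"]) auto
    from n(2) have "exp (c' * n) \<le> card D" unfolding D(4)[symmetric] card_image[OF D(3)] .
    with n(1) D(1-3) have "good k n D" by (simp add: good_def)
    then show ?thesis by blast
  qed
  then obtain n D where "\<And>k. good k (n k) (D k)" by metis
  then have n: "\<And>k. n k > k" and D: "\<And>k. D k \<subseteq> {x \<in> Sigma_m m. word_freq (n k) x \<in> A k}"
    "\<And>k. finite (D k)" "\<And>k. inj_on (word_prefix (n k)) (D k)" "\<And>k. exp (c' * n k) \<le> card (D k)"
    by (auto simp: good_def)
  \<comment> \<open>Slow progress through the lengths keeps each block short relative to the number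
    \<open>j\<close> of blocks before it, and \<open>j\<close> is at most
    \<open>offset len j\<close>. The condition \<open>n > k\<close> in \<open>good\<close> still
    sends the lengths to infinity.\<close>
  obtain \<kappa> where \<kappa>: "filterlim \<kappa> at_top sequentially" "(\<lambda>j. real (n (\<kappa> j)) / real j) \<longlonglongrightarrow> 0"
    using obtain_slow_sequence by metis
  define len where "len j = n (\<kappa> j)" for j
  have len: "len j > 0" for j using n[of "\<kappa> j"] by (simp add: len_def)
  have large: "filterlim len at_top sequentially"
    by (rule filterlim_at_top_mono[OF \<kappa>(1)]) (use n in \<open>auto simp: len_def less_imp_le\<close>)
  have small: "(\<lambda>j. len j / offset len j) \<longlonglongrightarrow> 0"
  proof (rule tendsto_sandwich[OF _ _ tendsto_const \<kappa>(2)])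
    show "eventually (\<lambda>j. len j / offset len j \<le> real (n (\<kappa> j)) / real j) sequentially"
      using eventually_gt_at_top[of 0]
    proof eventually_elim
      case (elim j)
      then show ?case
        using le_offset[of len j] len by (auto simp: len_def intro!: divide_left_mono)
    qed
  qed auto
  have "ereal c \<le> htop m (block_concat len ` (PiE UNIV (\<lambda>j. D (\<kappa> j))))"
    by (rule htop_block_concat_ge[OF len small _ _ _ c]) (use D in \<open>auto simp: len_def\<close>)
  also have "\<dots> \<le> htop m {x \<in> Sigma_m m. (\<lambda>n. word_freq n x) \<longlonglongrightarrow> \<nu>}"
  proof (intro htop_mono image_subsetI CollectI conjI)
    fix y assume "y \<in> PiE UNIV (\<lambda>j. D (\<kappa> j))"
    then have y: "y j \<in> Sigma_m m" "word_freq (len j) (y j) \<in> A (\<kappa> j)" for j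
      using D(1) by (fastforce simp: len_def)+
    then show "block_concat len y \<in> Sigma_m m" by (intro block_concat_in_Sigma_m)
    have "(\<lambda>j. word_freq (len j) (y j)) \<longlonglongrightarrow> \<nu>"
    proof (rule topological_tendstoI)
      fix S assume "open S" "\<nu> \<in> S"
      from eventually_compose_filterlim[OF A(3)[OF this] \<kappa>(1)]
      show "eventually (\<lambda>j. word_freq (len j) (y j) \<in> S) sequentially"
        by eventually_elim (use y in blast)
    qed
    then show "(\<lambda>n. word_freq n (block_concat len y)) \<longlonglongrightarrow> \<nu>"
      using len large small by (intro word_freq_block_concat_tendsto)
  qed
  finally show ?thesis .
qed

section \<open>Upper semicontinuity\<close>

lemma compact_unit_cube: "compact (PiE UNIV (\<lambda>_. {0..1}) :: ('a \<Rightarrow> real) set)"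
proof -
  have "compactin (product_topology (\<lambda>_. euclideanreal) UNIV) (PiE UNIV (\<lambda>_. {0..1}) :: ('a \<Rightarrow> real) set)"
    by (simp add: compactin_PiE)
  then show ?thesis by (simp add: euclidean_product_topology)
qed

lemma word_freq_in_unit_interval: "word_freq n x v \<in> {0..1}"
proof -
  have "(\<Sum>i=1..n. of_bool (word_prefix (length v) ((shift ^^ i) x) = v) :: real) \<le> (\<Sum>i=1..n. 1)"
    by (intro sum_mono) auto
  then show ?thesis by (auto simp: word_freq_def sum_nonneg divide_le_eq_1)
qed

text \<open>Pigeonhole: finitely many frequency neighbourhoods cover the cube, so one of them carries
  all but a bounded factor of the words. Choosing the point \<open>\<nu>\<close> once for the whole directed family,
  by compactness, avoids any countability assumption on the index set.\<close>

lemma obtain_rich_frequency: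
  fixes S :: "'i \<Rightarrow> nat \<Rightarrow> (nat \<Rightarrow> nat) set" and c c' :: real
  assumes sub: "\<And>i n. S i n \<subseteq> Sigma_m m"
    and directed: "\<And>J. finite J \<Longrightarrow> J \<subseteq> I \<Longrightarrow> \<exists>k\<in>I. \<forall>i\<in>J. \<forall>n. S k n \<subseteq> S i n"
    and many: "\<And>i. i \<in> I \<Longrightarrow> frequently (\<lambda>n. exp (c * n) \<le> card (word_prefix n ` S i n)) sequentially"
    and "c' < c"
  obtains \<nu> where "\<And>i N. i \<in> I \<Longrightarrow> open N \<Longrightarrow> \<nu> \<in> N \<Longrightarrow>
    frequently (\<lambda>n. exp (c' * n) \<le> card (word_prefix n ` {x \<in> S i n. word_freq n x \<in> N})) sequentially"
proof (rule ccontr)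
  assume no_thesis: "\<not> thesis"
  define bad where "bad \<nu> i N \<longleftrightarrow> i \<in> I \<and> open N \<and> \<nu> \<in> N \<and>
      eventually (\<lambda>n. card (word_prefix n ` {x \<in> S i n. word_freq n x \<in> N}) < exp (c' * n)) sequentially" for \<nu> i N
  have "\<exists>i N. bad \<nu> i N" for \<nu>
  proof (rule ccontr)
    assume "\<not> ?thesis"
    then have "i \<in> I \<Longrightarrow> open N \<Longrightarrow> \<nu> \<in> N \<Longrightarrow>
        frequently (\<lambda>n. exp (c' * n) \<le> card (word_prefix n ` {x \<in> S i n. word_freq n x \<in> N})) sequentially" for i N
      by (auto simp: bad_def frequently_def not_le)
    then show False using that no_thesis by blast
  qed
  then obtain i N where "\<And>\<nu>. bad \<nu> (i \<nu>) (N \<nu>)" by metis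
  then have iN: "\<And>\<nu>. i \<nu> \<in> I" "\<And>\<nu>. open (N \<nu>)" "\<And>\<nu>. \<nu> \<in> N \<nu>"
    "\<And>\<nu>. eventually (\<lambda>n. card (word_prefix n ` {x \<in> S (i \<nu>) n. word_freq n x \<in> N \<nu>}) < exp (c' * n)) sequentially"
    by (auto simp: bad_def)
  define K where "K = (PiE UNIV (\<lambda>_. {0..1}) :: (nat list \<Rightarrow> real) set)"
  obtain T where T: "T \<subseteq> K" "finite T" "K \<subseteq> (\<Union>\<nu>\<in>T. N \<nu>)"
    using compactE_image[of K K N] compact_unit_cube iN(2,3) by (metis K_def UN_I subsetI)
  \<comment> \<open>By directedness one index refines all those attached to the finite subcover, so
    every word of \<open>S k n\<close> is counted by some member of the cover.\<close>
  obtain k where k: "k \<in> I" "\<And>\<nu> n. \<nu> \<in> T \<Longrightarrow> S k n \<subseteq> S (i \<nu>) n"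
    using directed[of "i ` T"] T(2) iN(1) by (metis finite_imageI image_eqI image_subsetI)
  \<comment> \<open>The number of covering sets is fixed and is eventually beaten by the gap between
    the two exponents.\<close>
  have "filterlim (\<lambda>n. exp ((c - c') * real n)) at_top sequentially"
    using \<open>c' < c\<close> by (intro filterlim_compose[OF exp_at_top]
        filterlim_tendsto_pos_mult_at_top[OF tendsto_const] filterlim_real_sequentially) simp
  then have "eventually (\<lambda>n. real (card T) < exp ((c - c') * real n)) sequentially"
    by (simp add: filterlim_at_top_dense)
  moreover have "eventually (\<lambda>n. \<forall>\<nu>\<in>T. card (word_prefix n ` {x \<in> S (i \<nu>) n. word_freq n x \<in> N \<nu>}) < exp (c' * n)) sequentially"
    using T(2) iN(4) by (intro eventually_ball_finite) auto
  ultimately have "eventually (\<lambda>n. \<not> exp (c * n) \<le> card (word_prefix n ` S k n)) sequentially"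
  proof eventually_elim
    case (elim n)
    let ?B = "\<lambda>\<nu>. word_prefix n ` {x \<in> S (i \<nu>) n. word_freq n x \<in> N \<nu>}"
    have "word_freq n x \<in> K" for x
      using word_freq_in_unit_interval[of n x] by (auto simp: K_def)
    then have "word_prefix n ` S k n \<subseteq> (\<Union>\<nu>\<in>T. ?B \<nu>)"
      using T(3) k(2) by fastforce
    moreover have "finite (?B \<nu>)" for \<nu>
      using sub by (intro finite_word_prefix_image[of _ m]) blast
    ultimately have "card (word_prefix n ` S k n) \<le> card (\<Union>\<nu>\<in>T. ?B \<nu>)"
      using T(2) by (intro card_mono) auto
    also have "\<dots> \<le> (\<Sum>\<nu>\<in>T. card (?B \<nu>))"
      using T(2) by (rule card_UN_le)
    finally have "real (card (word_prefix n ` S k n)) \<le> (\<Sum>\<nu>\<in>T. real (card (?B \<nu>)))"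
      by (simp flip: of_nat_sum)
    also have "\<dots> \<le> (\<Sum>\<nu>\<in>T. exp (c' * n))"
      using elim(2) by (intro sum_mono) (auto simp: less_imp_le)
    also have "\<dots> = card T * exp (c' * n)" by simp
    also have "\<dots> < exp ((c - c') * n) * exp (c' * n)"
      using elim(1) by simp
    also have "\<dots> = exp (c * n)" by (simp add: algebra_simps flip: exp_add)
    finally show ?case by simp
  qed
  then show False using many[OF k(1)] by (simp add: frequently_def)
qed

section \<open>Evaluations and half-space neighbourhoods in the weak-star topology\<close>

lemma topspace_weak_star: "topspace (weak_star :: ('b::real_normed_vector \<Rightarrow>\<^sub>L real) topology) = UNIV"
proof -
  have "\<exists>w U. (UNIV :: ('b \<Rightarrow>\<^sub>L real) set) = {\<alpha>. blinfun_apply \<alpha> w \<in> U} \<and> open (U :: real set)"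
    by (intro exI[of _ 0] exI[of _ UNIV]) auto
  then show ?thesis unfolding weak_star_def topology_generated_by_topspace by blast
qed

lemma openin_weak_star_subbasic:
  "open U \<Longrightarrow> openin weak_star {\<alpha>. blinfun_apply \<alpha> w \<in> (U :: real set)}"
  unfolding weak_star_def by (rule topology_generated_by_Basis) blast

lemma continuous_map_weak_star_apply:
  "continuous_map weak_star euclideanreal (\<lambda>\<alpha>. blinfun_apply \<alpha> w)"
  by (auto simp: continuous_map topspace_weak_star intro: openin_weak_star_subbasic)

lemma openin_weak_star_less:
  assumes "finite F"
  shows "openin weak_star {\<alpha>. \<forall>w\<in>F. blinfun_apply \<alpha> w < b w}"
proof -
  have "openin weak_star ((\<Inter>w\<in>F. {\<alpha>. blinfun_apply \<alpha> w \<in> {..<b w}}) \<inter> topspace weak_star)"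
    using assms by (intro openin_INT openin_weak_star_subbasic) auto
  also have "(\<Inter>w\<in>F. {\<alpha>. blinfun_apply \<alpha> w \<in> {..<b w}}) \<inter> topspace weak_star
      = {\<alpha>. \<forall>w\<in>F. blinfun_apply \<alpha> w < b w}"
    by (auto simp: topspace_weak_star)
  finally show ?thesis .
qed

theorem theorem5p1:
  fixes m r :: nat
    and W :: "'b::banach set"
    and \<Phi> :: "(nat \<Rightarrow> (nat \<Rightarrow> nat)) \<Rightarrow> ('b \<Rightarrow>\<^sub>L real)"
  assumes "m \<ge> 2" and "r \<ge> 1"
    and "continuous_map (shift_power_space m r) weak_star \<Phi>"
  defines "L \<equiv> {\<alpha>. E_Phi m r \<Phi> \<alpha> W \<noteq> {}}"
    and "f \<equiv> (\<lambda>\<alpha>. htop m (E_Phi m r \<Phi> \<alpha> W))"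
  shows "\<forall>\<alpha>0\<in>L. \<forall>c. f \<alpha>0 < c \<longrightarrow>
           (\<exists>U. openin weak_star U \<and> \<alpha>0 \<in> U \<and> (\<forall>\<alpha>\<in>U \<inter> L. f \<alpha> < c))"
proof (intro ballI allI impI)
  fix \<alpha>0 c assume "\<alpha>0 \<in> L" and "f \<alpha>0 < c"
  \<comment> \<open>A real rate strictly between the two values: an upper bound by \<open>c1\<close>
    near \<open>\<alpha>0\<close> yields the strict inequality with \<open>c\<close>, which may be
    infinite.\<close>
  obtain c1 where c1: "f \<alpha>0 < ereal c1" "ereal c1 < c"
    using ereal_dense2[OF \<open>f \<alpha>0 < c\<close>] by blast
  \<comment> \<open>An index \<open>(F, d)\<close> keeps finitely many constraints and relaxes each
    by \<open>d\<close>.\<close>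
  define S where "S i n = {x \<in> Sigma_m m. \<forall>w\<in>fst i. blinfun_apply (V_Phi r \<Phi> n x) w \<le> blinfun_apply \<alpha>0 w + snd i}"
    for i :: "'b set \<times> real" and n
  define I where "I = {(F, d) |F d. finite F \<and> F \<subseteq> W \<and> (0::real) < d}"
  have S_sub: "S i n \<subseteq> Sigma_m m" for i n by (auto simp: S_def)
  have "\<exists>i\<in>I. \<not> frequently (\<lambda>n. exp (c1 * n) \<le> card (word_prefix n ` S i n)) sequentially"
  proof (rule ccontr)
    assume "\<not> ?thesis"
    then have many: "frequently (\<lambda>n. exp (c1 * n) \<le> card (word_prefix n ` S i n)) sequentially" if "i \<in> I" for i
      using that by blast
    \<comment> \<open>Two losses in the rate must fit above \<open>f \<alpha>0\<close>: from
      \<open>c1\<close> to \<open>c2\<close> in the pigeonhole argument, and from \<open>c2\<close>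
      to \<open>c3\<close> in the mass distribution.\<close>
    obtain c3 where c3: "f \<alpha>0 < ereal c3" "c3 < c1"
      using ereal_dense2[OF c1(1)] by auto
    obtain c2 where c2: "c3 < c2" "c2 < c1" using dense[OF c3(2)] by blast
    have "0 \<le> f \<alpha>0" using \<open>\<alpha>0 \<in> L\<close> by (auto simp: f_def L_def intro: htop_nonneg)
    then have "0 < c3" using c3(1) by (metis ereal_less(2) le_less_trans)
    have "\<exists>k\<in>I. \<forall>i\<in>J. \<forall>n. S k n \<subseteq> S i n" if "finite J" "J \<subseteq> I" for J
    proof (intro bexI ballI allI)
      \<comment> \<open>All constraints are united and the smallest tolerance is taken; the inserted
        1 serves the empty family.\<close>
      let ?k = "(\<Union>(fst ` J), Min (insert 1 (snd ` J)))"
      show "?k \<in> I" using that by (fastforce simp: I_def)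
      fix i n assume "i \<in> J"
      then have "fst i \<subseteq> fst ?k" "snd ?k \<le> snd i" using that(1) by auto
      then show "S ?k n \<subseteq> S i n" unfolding S_def by fastforce
    qed
    from obtain_rich_frequency[of S m I c1 c2, OF S_sub this many c2(2)]
    obtain \<nu> where \<nu>: "\<And>i N. i \<in> I \<Longrightarrow> open N \<Longrightarrow> \<nu> \<in> N \<Longrightarrow>
      frequently (\<lambda>n. exp (c2 * n) \<le> card (word_prefix n ` {x \<in> S i n. word_freq n x \<in> N})) sequentially"
      by blast
    have "ereal c3 \<le> htop m {x \<in> Sigma_m m. (\<lambda>n. word_freq n x) \<longlonglongrightarrow> \<nu>}"
    proof (rule htop_word_freq_tendsto_ge[OF _ \<open>0 < c3\<close> c2(1)])
      fix N assume "open N" "\<nu> \<in> N"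
      \<comment> \<open>The index without constraints, for which \<open>S\<close> is all of
        \<open>Sigma_m m\<close>.\<close>
      moreover have "({}, 1) \<in> I" by (simp add: I_def)
      ultimately show "frequently (\<lambda>n. exp (c2 * n) \<le> card (word_prefix n ` {x \<in> Sigma_m m. word_freq n x \<in> N})) sequentially"
        using \<nu>[of "({}, 1)" N] by (simp add: S_def)
    qed
    also have "\<dots> \<le> f \<alpha>0"
      unfolding f_def
    proof (rule htop_mono, clarify)
      fix x assume x: "x \<in> Sigma_m m" and lim: "(\<lambda>n. word_freq n x) \<longlonglongrightarrow> \<nu>"
      have "limsup (\<lambda>n. ereal (blinfun_apply (V_Phi r \<Phi> n x) w)) \<le> ereal (blinfun_apply \<alpha>0 w)" if "w \<in> W" for w
      proof (rule ereal_le_epsilon2)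
        fix e :: real assume "0 < e"
        define \<phi> where "\<phi> = (\<lambda>a. blinfun_apply (\<Phi> a) w)"
        have V: "blinfun_apply (V_Phi r \<Phi> n y) w = vstat r \<phi> n y" for n y
          by (simp add: V_Phi_apply \<phi>_def)
        have cont: "continuous_map (shift_power_space m r) euclideanreal \<phi>"
          using continuous_map_compose[OF assms(3) continuous_map_weak_star_apply[of w]]
          by (simp add: o_def \<phi>_def)
        have "0 < m" "0 < e / 2" using \<open>m \<ge> 2\<close> \<open>0 < e\<close> by auto
        then obtain N where N: "open N" "\<nu> \<in> N"
            "\<forall>n>0. \<forall>n'>0. \<forall>x\<in>Sigma_m m. \<forall>x'\<in>Sigma_m m. word_freq n x \<in> N \<longrightarrow> word_freq n' x' \<in> N \<longrightarrow>
            \<bar>vstat r \<phi> n x - vstat r \<phi> n' x'\<bar> < e / 2"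
          by (rule vstat_determined_by_word_freq[OF _ cont, where \<nu> = \<nu>])
        \<comment> \<open>One finite word with frequencies near \<open>\<nu>\<close> that satisfies
          the \<open>w\<close>-constraint up to \<open>e / 2\<close> suffices: the averages of
          \<open>x\<close> eventually differ from its average by less than
          \<open>e / 2\<close>.\<close>
        have "({w}, e / 2) \<in> I" using \<open>w \<in> W\<close> \<open>0 < e\<close> by (simp add: I_def)
        from \<nu>[OF this N(1,2)] obtain n' where n': "n' > 0"
          "exp (c2 * n') \<le> card (word_prefix n' ` {x \<in> S ({w}, e / 2) n'. word_freq n' x \<in> N})"
          unfolding frequently_sequentially by (meson Suc_le_lessD)
        have "{x \<in> S ({w}, e / 2) n'. word_freq n' x \<in> N} \<noteq> {}"
        proof
          assume "{x \<in> S ({w}, e / 2) n'. word_freq n' x \<in> N} = {}"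
          then show False using n'(2) by (simp add: not_le del: Collect_empty_eq)
        qed
        then obtain x' where x': "x' \<in> Sigma_m m" "word_freq n' x' \<in> N" "vstat r \<phi> n' x' \<le> blinfun_apply \<alpha>0 w + e / 2"
          by (auto simp: S_def V)
        show "limsup (\<lambda>n. ereal (blinfun_apply (V_Phi r \<Phi> n x) w)) \<le> ereal (blinfun_apply \<alpha>0 w) + ereal e"
        proof (rule Limsup_bounded)
          show "eventually (\<lambda>n. ereal (blinfun_apply (V_Phi r \<Phi> n x) w) \<le> ereal (blinfun_apply \<alpha>0 w) + ereal e) sequentially"
            using topological_tendstoD[OF lim N(1,2)] eventually_gt_at_top[of 0]
          proof eventually_elim
            case (elim n)
            then have "\<bar>vstat r \<phi> n x - vstat r \<phi> n' x'\<bar> < e / 2" using N(3) n'(1) x x' by blast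
            then have "vstat r \<phi> n x \<le> blinfun_apply \<alpha>0 w + e"
              using x'(3) unfolding abs_less_iff by linarith
            then show ?case by (simp add: V)
          qed
        qed
      qed
      then show "x \<in> E_Phi m r \<Phi> \<alpha>0 W" using x by (simp add: E_Phi_def)
    qed
    finally show False using c3(1) by simp
  qed
  then obtain F d where Fd: "finite F" "F \<subseteq> W" "0 < d"
    and few: "eventually (\<lambda>n. card (word_prefix n ` S (F, d) n) < exp (c1 * n)) sequentially"
    by (auto simp: I_def not_frequently not_le)
  define U where "U = {\<alpha>. \<forall>w\<in>F. blinfun_apply \<alpha> w < blinfun_apply \<alpha>0 w + d}"
  have "f \<alpha> < c" if "\<alpha> \<in> U" for \<alpha>
  proof -
    have "f \<alpha> \<le> ereal c1"
      unfolding f_def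
    proof (rule htop_le[OF _ S_sub])
      show "E_Phi m r \<Phi> \<alpha> W \<subseteq> Sigma_m m" by (auto simp: E_Phi_def)
      show "eventually (\<lambda>n. card (word_prefix n ` S (F, d) n) \<le> exp (c1 * n)) sequentially"
        using few by eventually_elim simp
      fix x assume x: "x \<in> E_Phi m r \<Phi> \<alpha> W"
      \<comment> \<open>For \<open>\<alpha>\<close> in \<open>U\<close> each limsup lies strictly
        below the relaxed bound; as \<open>F\<close> is finite, all its constraints hold
        simultaneously from some time on.\<close>
      have "eventually (\<lambda>n. \<forall>w\<in>F. blinfun_apply (V_Phi r \<Phi> n x) w \<le> blinfun_apply \<alpha>0 w + d) sequentially"
      proof (rule eventually_ball_finite[OF Fd(1)], rule ballI)
        fix w assume "w \<in> F"
        have "limsup (\<lambda>n. ereal (blinfun_apply (V_Phi r \<Phi> n x) w)) \<le> ereal (blinfun_apply \<alpha> w)"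
          using x \<open>w \<in> F\<close> Fd(2) by (auto simp: E_Phi_def)
        also have "\<dots> < ereal (blinfun_apply \<alpha>0 w + d)"
          using that \<open>w \<in> F\<close> by (simp add: U_def)
        finally show "eventually (\<lambda>n. blinfun_apply (V_Phi r \<Phi> n x) w \<le> blinfun_apply \<alpha>0 w + d) sequentially"
          by (auto dest!: Limsup_lessD elim!: eventually_mono)
      qed
      then show "eventually (\<lambda>n. x \<in> S (F, d) n) sequentially"
        using x by (auto simp: S_def E_Phi_def)
    qed
    then show ?thesis using c1(2) by simp
  qed
  moreover have "openin weak_star U" unfolding U_def by (rule openin_weak_star_less[OF Fd(1)])
  moreover have "\<alpha>0 \<in> U" using Fd(3) by (simp add: U_def)
  ultimately show "\<exists>U. openin weak_star U \<and> \<alpha>0 \<in> U \<and> (\<forall>\<alpha>\<in>U \<inter> L. f \<alpha> < c)" by blast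
qed

end
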